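(* Let $u$ be a solution of $i\partial_tu+\Delta u+|u|^2u=0$ defined on $[0,+\infty)$ such that $P[u]=0$ and $K=\{u(\cdot-x(t),t):\ t\in[0,+\infty)\}$ is precompact in $H^1(\mathbb{R}^3)$, for some continuous function $x(\cdot)$ with values in $\mathbb{R}^3$. Then $$\frac{x(t)}{t}\to0\quad\text{as } t\to+\infty.$$
   Context: Functions are complex-valued on $\mathbb{R}^3$; the equation is the focusing cubic NLS on $\mathbb{R}^3$ with initial data in $H^1(\mathbb{R}^3)$, and solutions are $H^1$ solutions. The momentum $P[u]=\operatorname{Im}\int\bar u(x,t)\nabla u(x,t)\,dx\in\mathbb{R}^3$ is conserved in time. A set is precompact in $H^1$ if its closure in $H^1$ is compact.
   Formalization: The solution u is additionally assumed not to be the zero solution; for u = 0 the claim is false, since K = {0} is compact and P[u] = 0 for every continuous x(t), e.g. x(t) = t e_1. *)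

theory Defs
  imports "HOL-Analysis.Analysis"
begin

type_synonym wave = "real^3 \<Rightarrow> complex"

section \<open>The Sobolev space \<open>H\<^sup>1(\<real>\<^sup>3)\<close>\<close>

definition partial :: "3 \<Rightarrow> (real^3 \<Rightarrow> real) \<Rightarrow> real^3 \<Rightarrow> real" where
  "partial i \<phi> x = frechet_derivative \<phi> (at x) (axis i 1)"

fun C_k :: "nat \<Rightarrow> (real^3 \<Rightarrow> real) \<Rightarrow> bool" where
  "C_k 0 \<phi> \<longleftrightarrow> continuous_on UNIV \<phi>"
| "C_k (Suc k) \<phi> \<longleftrightarrow> (\<forall>x. \<phi> differentiable (at x)) \<and> (\<forall>i. C_k k (partial i \<phi>))"

definition test_fun :: "(real^3 \<Rightarrow> real) \<Rightarrow> bool" where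
  "test_fun \<phi> \<longleftrightarrow> (\<forall>k. C_k k \<phi>) \<and> compact (closure {x. \<phi> x \<noteq> 0})"

definition square_integrable :: "(real^3 \<Rightarrow> 'b::euclidean_space) \<Rightarrow> bool" where
  "square_integrable f \<longleftrightarrow>
     f \<in> borel_measurable lebesgue \<and> integrable lebesgue (\<lambda>x. (norm (f x))\<^sup>2)"

definition has_weak_gradient :: "wave \<Rightarrow> (real^3 \<Rightarrow> complex^3) \<Rightarrow> bool" where
  "has_weak_gradient f G \<longleftrightarrow> square_integrable G \<and>
     (\<forall>\<phi> i. test_fun \<phi> \<longrightarrow>
        (LINT x|lebesgue. partial i \<phi> x *\<^sub>R f x) = - (LINT x|lebesgue. \<phi> x *\<^sub>R (G x $ i)))"

text \<open>Elements of \<open>H\<^sup>1\<close> are handled through representatives: \<open>H1\<close> is a set of functions,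
  \<open>H1_norm\<close> is a seminorm on it that vanishes exactly on the functions that are zero almost
  everywhere, and \<open>weak_gradient\<close> is determined up to a null set.\<close>

definition H1 :: "wave set" where
  "H1 = {f. square_integrable f \<and> (\<exists>G. has_weak_gradient f G)}"

definition weak_gradient :: "wave \<Rightarrow> real^3 \<Rightarrow> complex^3" where
  "weak_gradient f = (SOME G. has_weak_gradient f G)"

definition H1_norm :: "wave \<Rightarrow> real" where
  "H1_norm f = sqrt ((LINT x|lebesgue. (norm (f x))\<^sup>2)
                   + (LINT x|lebesgue. (norm (weak_gradient f x))\<^sup>2))"

text \<open>The norm topology of \<open>H\<^sup>1\<close>, pulled back to representatives. It does not separate functions
  that agree almost everywhere; passing to the quotient by this relation changes neither closures
  nor compactness nor continuity.\<close>

definition H1_topology :: "wave topology" where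
  "H1_topology =
     topology_generated_by {{g \<in> H1. H1_norm (\<lambda>x. g x - f x) < r} | f r. f \<in> H1 \<and> r > 0}"

section \<open>Solutions of the focusing cubic nonlinear Schroedinger equation\<close>

definition L2_pairing :: "wave \<Rightarrow> wave \<Rightarrow> complex" where
  "L2_pairing f \<phi> = (LINT x|lebesgue. f x * cnj (\<phi> x))"

text \<open>The distribution \<open>\<Delta>f \<in> H\<^sup>-\<^sup>1\<close> of an \<open>H\<^sup>1\<close> function \<open>f\<close>, acting on \<open>\<phi> \<in> H\<^sup>1\<close>.\<close>

definition laplacian_pairing :: "wave \<Rightarrow> wave \<Rightarrow> complex" where
  "laplacian_pairing f \<phi> =
     - (LINT x|lebesgue. (\<Sum>i\<in>UNIV. weak_gradient f x $ i * cnj (weak_gradient \<phi> x $ i)))"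

text \<open>\<open>H\<^sup>-\<^sup>1\<close> is the (anti-)dual of \<open>H\<^sup>1\<close>, with \<open>f \<in> H\<^sup>1\<close> embedded as \<open>L2_pairing f\<close>. The next
  definition says that the difference quotient of \<open>u\<close> at \<open>t\<close> converges to the functional \<open>L\<close> in
  the norm of \<open>H\<^sup>-\<^sup>1\<close>, that is, uniformly for \<open>\<phi>\<close> in the unit ball of \<open>H\<^sup>1\<close>; at \<open>t = 0\<close> the
  derivative is one-sided.\<close>

definition has_Hm1_derivative :: "(real \<Rightarrow> wave) \<Rightarrow> (wave \<Rightarrow> complex) \<Rightarrow> real \<Rightarrow> bool" where
  "has_Hm1_derivative u L t \<longleftrightarrow>
     (\<forall>\<epsilon>>0. \<forall>\<^sub>F s in at t within {0..}. \<forall>\<phi>\<in>H1.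
        norm (L2_pairing (\<lambda>x. u s x - u t x) \<phi> - of_real (s - t) * L \<phi>)
          \<le> \<epsilon> * \<bar>s - t\<bar> * H1_norm \<phi>)"

text \<open>An \<open>H\<^sup>1\<close> solution on \<open>[0, \<infinity>)\<close>: a curve in \<open>C([0, \<infinity>); H\<^sup>1)\<close>, differentiable in \<open>H\<^sup>-\<^sup>1\<close>, with
  \<open>\<i> \<partial>\<^sub>t u + \<Delta>u + |u|\<^sup>2 u = 0\<close> in \<open>H\<^sup>-\<^sup>1\<close> at every time. By the Sobolev embedding of \<open>H\<^sup>1\<close> in \<open>L\<^sup>4\<close> the
  integral against \<open>|u|\<^sup>2 u\<close> converges, and \<open>\<Delta>u + |u|\<^sup>2 u\<close> is continuous in time with values in
  \<open>H\<^sup>-\<^sup>1\<close>, so the curve is automatically in \<open>C\<^sup>1([0, \<infinity>); H\<^sup>-\<^sup>1)\<close>.\<close>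

definition NLS_solution :: "(real \<Rightarrow> wave) \<Rightarrow> bool" where
  "NLS_solution u \<longleftrightarrow>
     continuous_map (top_of_set {0..}) H1_topology u \<and>
     (\<forall>t\<ge>0. \<exists>L. has_Hm1_derivative u L t \<and>
        (\<forall>\<phi>\<in>H1. \<i> * L \<phi> + laplacian_pairing (u t) \<phi>
                  + L2_pairing (\<lambda>x. of_real ((cmod (u t x))\<^sup>2) * u t x) \<phi> = 0))"

definition momentum :: "wave \<Rightarrow> real^3" where
  "momentum f = (\<chi> i. Im (LINT x|lebesgue. cnj (f x) * (weak_gradient f x $ i)))"

end

theory Submission
  imports Defs "HOL-Computational_Algebra.Polynomial"
begin

text \<open>Fix a coordinate \<open>j\<close> and follow the bounded surrogate
  \<open>z(t) = \<integral> R sin (y\<^sub>j / R) |u(y, t)|\<^sup>2 dy\<close> of the \<open>j\<close>-th moment of the mass. Since the momentum vanishes,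
  \<open>z'(t) = 2 Im \<integral> (cos (y\<^sub>j / R) - 1) u\<^sup>* \<partial>\<^sub>j u dy\<close>. Precompactness makes the energy density uniformly
  tight around \<open>- x(t)\<close>; with \<open>R = K (max\<^bsub>[0,T]\<^esub> |x\<^sub>j| + A)\<close> the cosine is within \<open>1/K\<close> of \<open>1\<close> where the
  energy sits, so that \<open>|z'| \<le> \<eta>\<close> on \<open>[0, T]\<close> with \<open>\<eta>\<close> small. At a time \<open>s \<le> T\<close> where \<open>|x\<^sub>j|\<close> is maximal,
  \<open>|z(s)|\<close> is at least about \<open>|x\<^sub>j(s)| / 2\<close> times the conserved mass, which bounds \<open>|x\<^sub>j(T)|\<close> by
  \<open>\<delta> T + C\<close> for arbitrarily small \<open>\<delta>\<close>.\<close>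

section \<open>Smooth functions\<close>

text \<open>The first moment of the mass need not be finite for data in H^1. The weight R sin(y_j/R)
  is bounded with bounded derivatives, so multiplication by it preserves H^1, and its slope at the
  origin is 1, which is what lets the vanishing momentum cancel the main part of the flux. The price
  is that far mass is weighted by R, and R grows with the drift itself. This dictates the order of
  choices: \<open>K\<close> is fixed by the energy bound and \<delta>, then the tail size \<epsilon>
  is taken small compared with 1/\<open>K\<close>, then the radius \<open>A\<close>, all before T.
  The error is then a small fraction of the mass times (max |x_j| + A), and it can be absorbed only
  at a time where |x_j| attains that maximum.

  A second obstacle is regularity: u is differentiable in time only in H^-1. The weighted mass,
  quadratic in u, is expanded around u(t), and its remainder, paired through the same H^-1 estimate,
  is o(|s - t|) because u is continuous in H^1. The cubic term enters only through a real number and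
  vanishes on taking imaginary parts.\<close>

definition smooth :: "(real^3 \<Rightarrow> real) \<Rightarrow> bool" where
  "smooth \<phi> \<longleftrightarrow> (\<forall>k. C_k k \<phi>)"

lemma partial_eq: "(\<phi> has_derivative D) (at x) \<Longrightarrow> partial i \<phi> x = D (axis i 1)"
  by (metis frechet_derivative_at partial_def)

lemma C_k_decrease: "C_k (Suc k) \<phi> \<Longrightarrow> C_k k \<phi>"
proof (induction k arbitrary: \<phi>)
  case 0
  then show ?case
    by (simp add: continuous_on_eq_continuous_at differentiable_imp_continuous_within)
next
  case (Suc k)
  then show ?case by (metis C_k.simps(2))
qed

lemma C_k_const: "C_k k (\<lambda>x. c)"
proof (induction k arbitrary: c)
  case (Suc k)
  have "partial i (\<lambda>x. c) = (\<lambda>x. 0)" for i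
    by (rule ext, subst partial_eq[of _ "\<lambda>_. 0"]) auto
  then show ?case using Suc by simp
qed simp

lemma C_k_component: "C_k k (\<lambda>x. x $ j)"
proof (cases k)
  case 0
  then show ?thesis by (simp add: continuous_intros)
next
  case (Suc l)
  have d: "((\<lambda>x. x $ j) has_derivative (\<lambda>x. x $ j)) (at x)" for x :: "real^3"
    by (rule bounded_linear_imp_has_derivative) (rule bounded_linear_vec_nth)
  have "partial i (\<lambda>x. x $ j) = (\<lambda>x. axis i 1 $ j)" for i
    by (rule ext, subst partial_eq[OF d]) auto
  then show ?thesis using d C_k_const by (auto simp: Suc differentiable_def)
qed

lemma partial_add:
  assumes "\<phi> differentiable (at x)" "\<psi> differentiable (at x)"
  shows "partial i (\<lambda>x. \<phi> x + \<psi> x) x = partial i \<phi> x + partial i \<psi> x"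
proof -
  obtain D E where D: "(\<phi> has_derivative D) (at x)" and E: "(\<psi> has_derivative E) (at x)"
    using assms by (auto simp: differentiable_def)
  show ?thesis
    using partial_eq[OF D] partial_eq[OF E] partial_eq[OF has_derivative_add[OF D E]] by simp
qed

lemma partial_mult:
  assumes "\<phi> differentiable (at x)" "\<psi> differentiable (at x)"
  shows "partial i (\<lambda>x. \<phi> x * \<psi> x) x = \<phi> x * partial i \<psi> x + partial i \<phi> x * \<psi> x"
proof -
  obtain D E where D: "(\<phi> has_derivative D) (at x)" and E: "(\<psi> has_derivative E) (at x)"
    using assms by (auto simp: differentiable_def)
  show ?thesis
    using partial_eq[OF D] partial_eq[OF E] partial_eq[OF has_derivative_mult[OF D E]] by simp
qed

lemma C_k_add: "C_k k \<phi> \<Longrightarrow> C_k k \<psi> \<Longrightarrow> C_k k (\<lambda>x. \<phi> x + \<psi> x)"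
proof (induction k arbitrary: \<phi> \<psi>)
  case (Suc k)
  then have "partial i (\<lambda>x. \<phi> x + \<psi> x) = (\<lambda>x. partial i \<phi> x + partial i \<psi> x)" for i
    by (auto simp: partial_add)
  with Suc show ?case by simp
qed (simp add: continuous_on_add)

lemma C_k_mult: "C_k k \<phi> \<Longrightarrow> C_k k \<psi> \<Longrightarrow> C_k k (\<lambda>x. \<phi> x * \<psi> x)"
proof (induction k arbitrary: \<phi> \<psi>)
  case (Suc k)
  then have "partial i (\<lambda>x. \<phi> x * \<psi> x) = (\<lambda>x. \<phi> x * partial i \<psi> x + partial i \<phi> x * \<psi> x)" for i
    by (auto simp: partial_mult)
  with Suc C_k_decrease[of k \<phi>] C_k_decrease[of k \<psi>] show ?case by (simp add: C_k_add)
qed (simp add: continuous_on_mult)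

lemma partial_compose:
  fixes g g' :: "real \<Rightarrow> real"
  assumes "\<phi> differentiable (at x)" "\<And>s. (g has_real_derivative g' s) (at s)"
  shows "(\<lambda>x. g (\<phi> x)) differentiable (at x)"
    and "partial i (\<lambda>x. g (\<phi> x)) x = g' (\<phi> x) * partial i \<phi> x"
proof -
  obtain D where D: "(\<phi> has_derivative D) (at x)"
    using assms by (auto simp: differentiable_def)
  have g: "(g has_derivative (*) (g' (\<phi> x))) (at (\<phi> x))"
    using assms(2) by (simp add: has_field_derivative_def)
  have *: "((\<lambda>x. g (\<phi> x)) has_derivative (\<lambda>v. g' (\<phi> x) * D v)) (at x)"
    using has_derivative_compose[OF D g] .
  then show "(\<lambda>x. g (\<phi> x)) differentiable (at x)" by (auto simp: differentiable_def)
  show "partial i (\<lambda>x. g (\<phi> x)) x = g' (\<phi> x) * partial i \<phi> x"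
    using partial_eq[OF D] partial_eq[OF *] by simp
qed

text \<open>A whole sequence of successive derivatives is supplied, so one induction on
  \<open>k\<close> with \<open>n\<close> arbitrary covers every \<open>g n\<close>: the chain rule
  yields \<open>g (Suc n)\<close> times a partial of \<phi>, again a product of \<open>C_k\<close>
  functions.\<close>

lemma C_k_compose:
  fixes g :: "nat \<Rightarrow> real \<Rightarrow> real"
  assumes "\<And>n s. (g n has_real_derivative g (Suc n) s) (at s)"
  shows "C_k k \<phi> \<Longrightarrow> C_k k (\<lambda>x. g n (\<phi> x))"
proof (induction k arbitrary: \<phi> n)
  case 0
  have "continuous_on UNIV (g n)"
    by (meson DERIV_continuous assms continuous_at_imp_continuous_on)
  with 0 show ?case
    by (auto intro: continuous_on_compose2)
next
  case (Suc k)
  have "partial i (\<lambda>x. g n (\<phi> x)) = (\<lambda>x. g (Suc n) (\<phi> x) * partial i \<phi> x)" for i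
    using Suc.prems by (intro ext partial_compose(2)[OF _ assms]) simp
  moreover have "(\<lambda>x. g n (\<phi> x)) differentiable (at x)" for x
    using Suc.prems by (intro partial_compose(1)[OF _ assms]) simp
  ultimately show ?case using Suc C_k_decrease[of k \<phi>] by (simp add: C_k_mult)
qed

lemma partial_translate:
  assumes "\<phi> differentiable (at (x + a))"
  shows "(\<lambda>x. \<phi> (x + a)) differentiable (at x)"
    and "partial i (\<lambda>x. \<phi> (x + a)) x = partial i \<phi> (x + a)"
proof -
  obtain D where D: "(\<phi> has_derivative D) (at (x + a))"
    using assms by (auto simp: differentiable_def)
  have "((\<lambda>x. x + a) has_derivative (\<lambda>v. v)) (at x)"
    by (auto intro!: derivative_eq_intros)
  from has_derivative_compose[OF this D]
  have *: "((\<lambda>x. \<phi> (x + a)) has_derivative D) (at x)" .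
  then show "(\<lambda>x. \<phi> (x + a)) differentiable (at x)" by (auto simp: differentiable_def)
  show "partial i (\<lambda>x. \<phi> (x + a)) x = partial i \<phi> (x + a)"
    using partial_eq[OF D] partial_eq[OF *] by simp
qed

lemma C_k_translate: "C_k k \<phi> \<Longrightarrow> C_k k (\<lambda>x. \<phi> (x + a))"
proof (induction k arbitrary: \<phi>)
  case 0
  then show ?case by (auto intro!: continuous_on_compose2[of UNIV \<phi>] continuous_intros)
next
  case (Suc k)
  have "partial i (\<lambda>x. \<phi> (x + a)) = (\<lambda>x. partial i \<phi> (x + a))" for i
    using Suc.prems by (auto intro!: partial_translate)
  with Suc show ?case by (auto intro!: partial_translate)
qed

lemma smooth_D:
  assumes "smooth \<phi>"
  shows "\<phi> differentiable (at x)" "smooth (partial i \<phi>)" "continuous_on UNIV \<phi>"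
proof -
  have *: "C_k (Suc k) \<phi>" "C_k 0 \<phi>" for k using assms unfolding smooth_def by blast+
  show "\<phi> differentiable (at x)" "smooth (partial i \<phi>)" "continuous_on UNIV \<phi>"
    using * by (auto simp: smooth_def)
qed

lemma smooth_sin_component: "smooth (\<lambda>x. R * sin (x $ j / R))"
proof -
  \<comment> \<open>Shifts by quarter periods give a closed form for all derivatives of sine;
    \<open>n = 0\<close> is sine itself.\<close>
  have "((\<lambda>s. sin (s + real n * (pi/2))) has_real_derivative sin (s + real (Suc n) * (pi/2))) (at s)" for n s
  proof -
    have "s + real (Suc n) * (pi/2) = s + real n * (pi/2) + pi/2" by (simp add: field_simps)
    then have "sin (s + real (Suc n) * (pi/2)) = cos (s + real n * (pi/2))"
      by (simp only: sin_add sin_pi_half cos_pi_half)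
    then show ?thesis by (auto intro!: derivative_eq_intros)
  qed
  from C_k_compose[of "\<lambda>n s. sin (s + real n * (pi/2))", OF this, of _ _ 0]
  have "C_k k (\<lambda>x. sin (x $ j * inverse R))" for k
    using C_k_mult[OF C_k_component C_k_const] by simp
  then show ?thesis using C_k_mult[OF C_k_const] by (simp add: smooth_def divide_inverse)
qed

lemma test_fun_mult:
  assumes "smooth \<phi>" "test_fun \<psi>"
  shows "test_fun (\<lambda>x. \<phi> x * \<psi> x)"
proof -
  have "closure {x. \<phi> x * \<psi> x \<noteq> 0} \<subseteq> closure {x. \<psi> x \<noteq> 0}" by (rule closure_mono) auto
  then have "compact (closure {x. \<phi> x * \<psi> x \<noteq> 0})"
    using assms(2) compact_Int_closed[of "closure {x. \<psi> x \<noteq> 0}" "closure {x. \<phi> x * \<psi> x \<noteq> 0}"]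
    by (simp add: test_fun_def inf.absorb2)
  then show ?thesis using assms unfolding test_fun_def smooth_def by (blast intro: C_k_mult)
qed

lemma test_fun_translate:
  assumes "test_fun \<psi>"
  shows "test_fun (\<lambda>x. \<psi> (x + a))"
proof -
  have "{x. \<psi> (x + a) \<noteq> 0} = (\<lambda>x. x - a) ` {x. \<psi> x \<noteq> 0}"
    by (auto simp: image_iff) (metis add_diff_cancel_right')
  then have "closure {x. \<psi> (x + a) \<noteq> 0} = (\<lambda>x. x - a) ` closure {x. \<psi> x \<noteq> 0}"
    by (simp only: closure_translation_subtract)
  then have "compact (closure {x. \<psi> (x + a) \<noteq> 0})"
    using assms by (simp add: test_fun_def compact_translation_subtract)
  then show ?thesis using assms unfolding test_fun_def by (blast intro: C_k_translate)
qed

section \<open>Test functions and the fundamental lemma\<close>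

lemma poly_div_exp_tendsto_0:
  "((\<lambda>s::real. poly p s / exp s) \<longlongrightarrow> 0) at_top"
proof -
  \<comment> \<open>The factor \<open>s ^ k\<close> strengthens the induction: splitting off the
    constant coefficient raises the power by one.\<close>
  have "((\<lambda>s. s ^ k * poly p s / exp s) \<longlongrightarrow> 0) at_top" for k
  proof (induction p arbitrary: k)
    case (pCons a p)
    have "((\<lambda>s. a * (s ^ k / exp s) + s ^ Suc k * poly p s / exp s) \<longlongrightarrow> a * 0 + 0) at_top"
      by (intro tendsto_intros tendsto_power_div_exp_0 pCons)
    then show ?case by (simp add: field_simps)
  qed simp
  from this[of 0] show ?thesis by simp
qed

text \<open>\<open>flat n\<close> is the \<open>n\<close>-th derivative of \<open>t \<mapsto> exp (-1/t)\<close> extended by \<open>0\<close> to \<open>t \<le> 0\<close>.\<close>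

fun flat_poly :: "nat \<Rightarrow> real poly" where
  "flat_poly 0 = 1"
| "flat_poly (Suc n) = [:0, 0, 1:] * (flat_poly n - pderiv (flat_poly n))"

definition flat :: "nat \<Rightarrow> real \<Rightarrow> real" where
  "flat n t = (if t \<le> 0 then 0 else poly (flat_poly n) (1 / t) * exp (- (1 / t)))"

text \<open>With s = 1/t, the t-derivative of p(s) exp(-s) is s^2 (p(s) - dp/ds) exp(-s), the
  recursion of \<open>flat_poly\<close>. At t = 0 the right difference quotient is s p(s) exp(-s)
  with s tending to infinity, where the exponential wins.\<close>

lemma has_real_derivative_flat: "(flat n has_real_derivative flat (Suc n) t) (at t)"
proof (cases t "0::real" rule: linorder_cases)
  case less
  have "((\<lambda>_. 0) has_real_derivative flat (Suc n) t) (at t)"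
    using less by (simp add: flat_def)
  then show ?thesis
    by (rule DERIV_cong_ev[THEN iffD1, rotated 3])
      (use less in \<open>auto simp: flat_def intro!: eventually_mono[OF eventually_nhds_in_open[of "{..<0}"]]\<close>)
next
  case equal
  have L: "((\<lambda>y. (flat n y - flat n 0) / (y - 0)) \<longlongrightarrow> 0) (at_left 0)"
    by (rule tendsto_eventually) (auto simp: flat_def eventually_at_filter)
  have "((\<lambda>s::real. poly ([:0, 1:] * flat_poly n) s / exp s) \<longlongrightarrow> 0) at_top"
    by (rule poly_div_exp_tendsto_0)
  then have "((\<lambda>s. (flat n (inverse s) - flat n 0) / (inverse s - 0)) \<longlongrightarrow> 0) at_top"
    by (rule Lim_transform_eventually)
      (auto simp: flat_def exp_minus field_simps intro!: eventually_mono[OF eventually_gt_at_top[of 0]])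
  then have R: "((\<lambda>y. (flat n y - flat n 0) / (y - 0)) \<longlongrightarrow> 0) (at_right 0)"
    by (simp only: filterlim_at_right_to_top)
  show ?thesis
    using filterlim_split_at[OF L R] by (simp add: equal has_field_derivative_iff flat_def)
next
  case greater
  have "((\<lambda>s. poly (flat_poly n) (1 / s) * exp (- (1 / s))) has_real_derivative flat (Suc n) t) (at t)"
    using greater
    by (auto intro!: derivative_eq_intros DERIV_chain2[OF poly_DERIV] simp: flat_def field_simps power2_eq_square)
  then show ?thesis
    by (rule DERIV_cong_ev[THEN iffD1, rotated 3])
      (use greater in \<open>auto simp: flat_def intro!: eventually_mono[OF eventually_nhds_in_open[of "{0<..}"]]\<close>)
qed

lemma flat_bounds: "0 \<le> flat 0 t" "flat 0 t \<le> 1"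
  by (auto simp: flat_def)

text \<open>\<open>flat 0\<close> only approaches 1 at infinity, so its argument is stretched:
  exp(-1/(n t)) tends to 1 for each t > 0.\<close>

lemma flat_scale_tendsto: "(\<lambda>n. flat 0 (real n * t)) \<longlonglongrightarrow> (if t > 0 then 1 else 0)"
proof (cases "t > 0")
  case True
  have "(\<lambda>n. exp (- (inverse (real n) * (1 / t)))) \<longlonglongrightarrow> exp (- (0 * (1 / t)))"
    by (intro tendsto_intros lim_inverse_n)
  then have "(\<lambda>n. flat 0 (real n * t)) \<longlonglongrightarrow> exp (- (0 * (1 / t)))"
    by (rule Lim_transform_eventually)
      (use True in \<open>auto simp: flat_def field_simps mult_le_0_iff intro!: eventually_mono[OF eventually_gt_at_top[of 0]]\<close>)
  with True show ?thesis by simp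
next
  case False
  then have "flat 0 (real n * t) = 0" for n by (simp add: flat_def mult_le_0_iff)
  with False show ?thesis by simp
qed

text \<open>Two one-sided cutoffs per coordinate. All \<open>n\<close> share the same box as support
  bound, and the pointwise limit is the indicator of the open box, as dominated convergence
  requires.\<close>

definition bump :: "real^3 \<Rightarrow> real^3 \<Rightarrow> nat \<Rightarrow> real^3 \<Rightarrow> real" where
  "bump a b n x = (\<Prod>i\<in>UNIV. flat 0 (real n * (x $ i - a $ i)) * flat 0 (real n * (b $ i - x $ i)))"

lemma C_k_prod:
  "finite S \<Longrightarrow> (\<And>i. i \<in> S \<Longrightarrow> C_k k (f i)) \<Longrightarrow> C_k k (\<lambda>x. \<Prod>i\<in>S. f i x)"
  by (induction S rule: finite_induct) (auto simp: C_k_const intro: C_k_mult)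

lemma bump_outside: "x \<notin> box a b \<Longrightarrow> bump a b n x = 0"
  by (auto simp: bump_def mem_box_cart flat_def mult_le_0_iff not_less)

lemma bump_bounds: "0 \<le> bump a b n x" "bump a b n x \<le> 1"
  using flat_bounds by (auto simp: bump_def intro!: prod_nonneg prod_le_1 mult_nonneg_nonneg mult_le_one)

lemma test_fun_bump: "test_fun (bump a b n)"
proof -
  have *: "C_k k (\<lambda>x. c * x $ i + d)" for k c i d
    by (intro C_k_add C_k_mult C_k_const C_k_component)
  have "C_k k (bump a b n)" for k
  proof -
    have "C_k k (\<lambda>x. flat 0 (real n * x $ i + - (real n * a $ i)) * flat 0 ((- real n) * x $ i + real n * b $ i))" for i
      by (intro C_k_mult C_k_compose[of flat] has_real_derivative_flat *)
    then have "C_k k (\<lambda>x. flat 0 (real n * (x $ i - a $ i)) * flat 0 (real n * (b $ i - x $ i)))" for i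
      by (simp add: algebra_simps)
    then show ?thesis unfolding bump_def[abs_def] by (intro C_k_prod) auto
  qed
  moreover have "closure {x. bump a b n x \<noteq> 0} \<subseteq> cbox a b"
    using bump_outside box_subset_cbox by (intro closure_minimal) (auto, blast)
  then have "compact (closure {x. bump a b n x \<noteq> 0})"
    using compact_Int_closed[of "cbox a b" "closure {x. bump a b n x \<noteq> 0}"] by (simp add: inf.absorb2)
  ultimately show ?thesis by (simp add: test_fun_def)
qed

lemma bump_tendsto: "(\<lambda>n. bump a b n x) \<longlonglongrightarrow> indicator (box a b) x"
proof -
  have "(\<lambda>n. bump a b n x) \<longlonglongrightarrow>
     (\<Prod>i\<in>UNIV. (if x $ i - a $ i > 0 then 1 else 0) * (if b $ i - x $ i > 0 then 1 else 0))"
    unfolding bump_def by (intro tendsto_intros flat_scale_tendsto)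
  also have "(\<Prod>i\<in>UNIV. (if x $ i - a $ i > 0 then 1 else 0) * (if b $ i - x $ i > 0 then 1 else 0))
      = (indicator (box a b) x :: real)"
    by (auto simp: indicator_def mem_box_cart)
  finally show ?thesis .
qed

lemma continuous_borel_measurable_lebesgue:
  fixes f :: "'a::euclidean_space \<Rightarrow> 'b::topological_space"
  assumes "continuous_on UNIV f"
  shows "f \<in> borel_measurable lebesgue"
  using assms by (auto intro!: measurable_completion borel_measurable_continuous_onI)

lemma square_integrable_cbox:
  fixes g :: wave
  assumes "square_integrable g"
  shows "integrable lebesgue (\<lambda>x. indicator (cbox a b) x *\<^sub>R g x)"
proof (rule Bochner_Integration.integrable_bound)
  show "integrable lebesgue (\<lambda>x. indicator (cbox a b) x + (norm (g x))\<^sup>2)"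
    using assms lmeasurable_cbox[of a b]
    by (intro Bochner_Integration.integrable_add) (auto simp: square_integrable_def lmeasurable_iff_integrable)
  show "(\<lambda>x. indicator (cbox a b) x *\<^sub>R g x) \<in> borel_measurable lebesgue"
    using assms fmeasurableD[OF lmeasurable_cbox[of a b]]
    by (intro borel_measurable_scaleR borel_measurable_indicator) (auto simp: square_integrable_def)
  have "norm (g x) \<le> 1 + (norm (g x))\<^sup>2" for x
    using zero_le_power2[of "norm (g x) - 1/2"] by (simp add: power2_eq_square algebra_simps)
  then show "AE x in lebesgue. norm (indicator (cbox a b) x *\<^sub>R g x) \<le> norm (indicator (cbox a b) x + (norm (g x))\<^sup>2)"
    by (auto simp: indicator_def)
qed

text \<open>Fundamental lemma of the calculus of variations. Testing with bumps and passing to the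
  limit makes the integral over every box vanish, and a function is determined almost everywhere by
  its box averages.\<close>

lemma AE_zero_if_test_fun_orthogonal:
  fixes g :: wave
  assumes g: "square_integrable g" and 0: "\<And>\<phi>. test_fun \<phi> \<Longrightarrow> (LINT x|lebesgue. \<phi> x *\<^sub>R g x) = 0"
  shows "AE x in lebesgue. g x = 0"
proof -
  have int: "set_integrable lebesgue (cbox a b) g" for a b
    using square_integrable_cbox[OF g] by (simp add: set_integrable_def)
  have [measurable]: "g \<in> borel_measurable lebesgue" using g by (simp add: square_integrable_def)
  have box0: "integral (cbox a b) g = 0" for a b
  proof -
    have [measurable]: "bump a b n \<in> borel_measurable lebesgue" for n
      using test_fun_bump[of a b n] C_k.simps(1) unfolding test_fun_def
      by (blast intro: continuous_borel_measurable_lebesgue)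
    have "(\<lambda>n. LINT x|lebesgue. bump a b n x *\<^sub>R g x) \<longlonglongrightarrow> (LINT x|lebesgue. indicator (box a b) x *\<^sub>R g x)"
    proof (rule integral_dominated_convergence)
      show "integrable lebesgue (\<lambda>x. norm (indicator (cbox a b) x *\<^sub>R g x))"
        using square_integrable_cbox[OF g] by (rule integrable_norm)
      show "AE x in lebesgue. (\<lambda>n. bump a b n x *\<^sub>R g x) \<longlonglongrightarrow> indicator (box a b) x *\<^sub>R g x"
        by (intro AE_I2 tendsto_intros bump_tendsto)
      show "AE x in lebesgue. norm (bump a b n x *\<^sub>R g x) \<le> norm (indicator (cbox a b) x *\<^sub>R g x)" for n
      proof (rule AE_I2)
        fix x
        have "bump a b n x = 0" if "x \<notin> cbox a b"
          using that bump_outside box_subset_cbox by blast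
        then show "norm (bump a b n x *\<^sub>R g x) \<le> norm (indicator (cbox a b) x *\<^sub>R g x)"
          using bump_bounds[of a b n x] by (auto simp: indicator_def mult_left_le_one_le)
      qed
      show "(\<lambda>x. indicator (box a b) x *\<^sub>R g x) \<in> borel_measurable lebesgue"
        by (intro borel_measurable_scaleR borel_measurable_indicator) (auto simp: fmeasurableD)
    qed auto
    then have "(LINT x:box a b|lebesgue. g x) = 0"
      using 0[OF test_fun_bump] by (simp add: LIMSEQ_const_iff set_lebesgue_integral_def)
    moreover have "set_integrable lebesgue (box a b) g"
      using int[of a b] by (rule set_integrable_subset) (auto simp: box_subset_cbox)
    ultimately show ?thesis
      using set_lebesgue_integral_eq_integral(2)[of "box a b" g] integral_open_interval[of a b g] by simp
  qed
  have "\<And>a b. g integrable_on cbox a b"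
    using int by (rule set_lebesgue_integral_eq_integral(1))
  \<comment> \<open>Lebesgue differentiation: off a negligible set the averages over cubes with
    lowest corner \<open>x\<close> converge to \<open>g x\<close>. Here all averages are 0.\<close>
  from integrable_ccontinuous_explicit[OF this] obtain N where "negligible N" and
    N: "\<And>x e. \<lbrakk>x \<notin> N; 0 < e\<rbrakk> \<Longrightarrow> \<exists>d>0. \<forall>h. 0 < h \<and> h < d \<longrightarrow>
            norm (integral (cbox x (x + h *\<^sub>R One)) g /\<^sub>R h ^ DIM(real^3) - g x) < e" by metis
  have "g x = 0" if x: "x \<notin> N" for x
  proof (rule ccontr)
    assume "g x \<noteq> 0"
    then obtain d where "d > 0" "\<forall>h. 0 < h \<and> h < d \<longrightarrow>
            norm (integral (cbox x (x + h *\<^sub>R One)) g /\<^sub>R h ^ DIM(real^3) - g x) < norm (g x)"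
      using N[OF x, of "norm (g x)"] by auto
    then have "norm (integral (cbox x (x + (d/2) *\<^sub>R One)) g /\<^sub>R (d/2) ^ DIM(real^3) - g x) < norm (g x)"
      by (auto dest: spec[of _ "d/2"])
    then show False by (simp add: box0)
  qed
  moreover have "N \<in> null_sets lebesgue" using \<open>negligible N\<close> negligible_iff_null_sets by blast
  ultimately show ?thesis by (auto intro: AE_I')
qed

section \<open>Weak gradients\<close>

lemma lebesgue_distr_translate:
  fixes a :: "'a::euclidean_space"
  shows "distr lebesgue lebesgue (\<lambda>x. x + a) = lebesgue"
    and "(\<lambda>x. x + a) \<in> lebesgue \<rightarrow>\<^sub>M lebesgue"
proof -
  have *: "(\<lambda>x. a + (\<Sum>j\<in>Basis. (1 * (x \<bullet> j)) *\<^sub>R j)) = (\<lambda>x. x + a)"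
    by (auto simp: euclidean_representation add.commute)
  show "distr lebesgue lebesgue (\<lambda>x. x + a) = lebesgue"
    using lebesgue_affine_euclidean[of "\<lambda>_. 1" a] by (simp only: *) (simp add: density_1)
  show "(\<lambda>x. x + a) \<in> lebesgue \<rightarrow>\<^sub>M lebesgue"
    using lebesgue_affine_measurable[of "\<lambda>_. 1" a] by (simp only: *)
qed

lemma lebesgue_integral_translate:
  fixes f :: "'a::euclidean_space \<Rightarrow> 'b::{banach, second_countable_topology}"
  assumes "f \<in> borel_measurable lebesgue"
  shows "(\<lambda>x. f (x + a)) \<in> borel_measurable lebesgue"
    and "(LINT x|lebesgue. f (x + a)) = (LINT x|lebesgue. f x)"
    and "integrable lebesgue (\<lambda>x. f (x + a)) \<longleftrightarrow> integrable lebesgue f"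
  using measurable_compose[OF lebesgue_distr_translate(2)[of a] assms]
    integral_distr[OF lebesgue_distr_translate(2)[of a] assms]
    integrable_distr_eq[OF lebesgue_distr_translate(2)[of a] assms]
  by (simp_all add: lebesgue_distr_translate(1))

section \<open>Square-integrable functions and their products\<close>

lemma square_integrable_bounded:
  assumes "square_integrable f" "h \<in> borel_measurable lebesgue" "\<And>x. norm (h x) \<le> C * norm (f x)"
  shows "square_integrable h"
proof -
  have [measurable]: "h \<in> borel_measurable lebesgue" by fact
  have "integrable lebesgue (\<lambda>x. (norm (h x))\<^sup>2)"
  proof (rule Bochner_Integration.integrable_bound)
    show "integrable lebesgue (\<lambda>x. C\<^sup>2 * (norm (f x))\<^sup>2)"
      using assms by (auto simp: square_integrable_def)
    show "AE x in lebesgue. norm ((norm (h x))\<^sup>2) \<le> norm (C\<^sup>2 * (norm (f x))\<^sup>2)"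
      using power_mono[OF assms(3), of _ 2] by (auto simp: power_mult_distrib)
  qed simp
  then show ?thesis using assms by (simp add: square_integrable_def)
qed

lemma power2_norm_add_le: "(norm (a + b))\<^sup>2 \<le> 2 * ((norm a)\<^sup>2 + (norm b)\<^sup>2)"
proof -
  have "(norm (a + b))\<^sup>2 \<le> (norm a + norm b)\<^sup>2" by (intro power_mono norm_triangle_ineq) simp
  also have "\<dots> \<le> 2 * ((norm a)\<^sup>2 + (norm b)\<^sup>2)"
    using zero_le_power2[of "norm a - norm b"] by (simp add: power2_eq_square algebra_simps)
  finally show ?thesis .
qed

lemma square_integrable_add:
  assumes f: "square_integrable f" and g: "square_integrable g"
  shows "square_integrable (\<lambda>x. f x + g x)"
proof -
  have [measurable]: "f \<in> borel_measurable lebesgue" "g \<in> borel_measurable lebesgue"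
    using f g by (auto simp: square_integrable_def)
  have "integrable lebesgue (\<lambda>x. (norm (f x + g x))\<^sup>2)"
  proof (rule Bochner_Integration.integrable_bound)
    show "integrable lebesgue (\<lambda>x. 2 * ((norm (f x))\<^sup>2 + (norm (g x))\<^sup>2))"
      using f g by (auto simp: square_integrable_def)
  qed (use power2_norm_add_le in \<open>auto simp: distrib_left\<close>)
  then show ?thesis by (simp add: square_integrable_def)
qed

lemma square_integrable_diff:
  assumes f: "square_integrable f" and g: "square_integrable g"
  shows "square_integrable (\<lambda>x. f x - g x)"
proof -
  have "square_integrable (\<lambda>x. - g x)"
    by (rule square_integrable_bounded[OF g, of _ 1]) (use g in \<open>auto simp: square_integrable_def\<close>)
  from square_integrable_add[OF f this] show ?thesis by simp
qed

text \<open>Since |f||g| is at most |f|^2 + |g|^2, one domination serves all quadratic integrands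
  below: weighted masses, pairings and currents.\<close>

lemma integrable_product:
  fixes h :: "real^3 \<Rightarrow> 'c::{banach, second_countable_topology}"
  assumes f: "square_integrable f" and g: "square_integrable g"
    and h: "h \<in> borel_measurable lebesgue" "\<And>x. norm (h x) \<le> C * (norm (f x) * norm (g x))"
  shows "integrable lebesgue h"
proof (rule Bochner_Integration.integrable_bound)
  show "integrable lebesgue (\<lambda>x. \<bar>C\<bar> * ((norm (f x))\<^sup>2 + (norm (g x))\<^sup>2))"
    using f g by (auto simp: square_integrable_def)
  have "norm (h x) \<le> \<bar>C\<bar> * ((norm (f x))\<^sup>2 + (norm (g x))\<^sup>2)" for x
  proof -
    have "norm (h x) \<le> \<bar>C\<bar> * (norm (f x) * norm (g x))"
      using h(2)[of x] by (rule order_trans) (intro mult_right_mono, auto)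
    also have "norm (f x) * norm (g x) \<le> (norm (f x))\<^sup>2 + (norm (g x))\<^sup>2"
      using zero_le_power2[of "norm (f x) - norm (g x)"]
        zero_le_power2[of "norm (f x)"] zero_le_power2[of "norm (g x)"]
      unfolding power2_diff by linarith
    finally show ?thesis by (simp add: mult_left_mono)
  qed
  then show "AE x in lebesgue. norm (h x) \<le> norm (\<bar>C\<bar> * ((norm (f x))\<^sup>2 + (norm (g x))\<^sup>2))"
    by (intro AE_I2) (smt (verit) real_norm_def)
qed fact

lemma integrable_scaleR_product:
  assumes "square_integrable f" "square_integrable g"
  shows "integrable lebesgue (\<lambda>x. f x *\<^sub>R g x)"
  using assms by (intro integrable_product[where C=1, OF assms] borel_measurable_scaleR)
    (auto simp: square_integrable_def)

lemma borel_measurable_cnj: "f \<in> borel_measurable M \<Longrightarrow> (\<lambda>x. cnj (f x)) \<in> borel_measurable M"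
  by (rule borel_measurable_continuous_on[where f=cnj]) (auto intro: continuous_intros)

lemma integrable_cnj_product:
  assumes "square_integrable f" "square_integrable g"
  shows "integrable lebesgue (\<lambda>x. f x * cnj (g x))"
proof (rule integrable_product[where C=1, OF assms])
  have [measurable]: "f \<in> borel_measurable lebesgue" "g \<in> borel_measurable lebesgue"
    using assms by (auto simp: square_integrable_def)
  show "(\<lambda>x. f x * cnj (g x)) \<in> borel_measurable lebesgue"
    by (intro borel_measurable_times borel_measurable_cnj) auto
qed (simp add: norm_mult)

lemma vec_borel_measurable_iff:
  fixes G :: "'a \<Rightarrow> complex^3"
  shows "G \<in> borel_measurable M \<longleftrightarrow> (\<forall>i. (\<lambda>x. G x $ i) \<in> borel_measurable M)"
proof safe
  fix i assume "G \<in> borel_measurable M"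
  then show "(\<lambda>x. G x $ i) \<in> borel_measurable M"
    by (rule borel_measurable_continuous_on[where f="\<lambda>v. v $ i", rotated]) (simp add: continuous_on_component)
next
  assume "\<forall>i. (\<lambda>x. G x $ i) \<in> borel_measurable M"
  then show "G \<in> borel_measurable M"
    by (subst borel_measurable_euclidean_space) (auto simp: Basis_vec_def inner_axis intro!: borel_measurable_inner)
qed

lemma norm_vec_power2: "(norm (v :: complex^3))\<^sup>2 = (\<Sum>i\<in>UNIV. (norm (v $ i))\<^sup>2)"
  by (simp add: norm_vec_def L2_set_def sum_nonneg)

lemma square_integrable_vec_iff:
  fixes G :: "real^3 \<Rightarrow> complex^3"
  shows "square_integrable G \<longleftrightarrow> (\<forall>i. square_integrable (\<lambda>x. G x $ i))"
proof safe
  fix i assume G: "square_integrable G"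
  show "square_integrable (\<lambda>x. G x $ i)"
    by (rule square_integrable_bounded[OF G, of _ 1])
      (use G in \<open>auto simp: square_integrable_def vec_borel_measurable_iff component_le_norm_cart Finite_Cartesian_Product.norm_nth_le\<close>)
next
  assume "\<forall>i. square_integrable (\<lambda>x. G x $ i)"
  then show "square_integrable G"
    by (auto simp: square_integrable_def vec_borel_measurable_iff norm_vec_power2)
qed

lemma test_fun_D:
  assumes "test_fun \<phi>"
  shows "smooth \<phi>" "test_fun (partial i \<phi>)" "square_integrable \<phi>"
proof -
  show s: "smooth \<phi>" using assms by (simp add: test_fun_def smooth_def)
  have z: "partial i \<phi> x = 0" if "x \<notin> closure {x. \<phi> x \<noteq> 0}" for x
  proof -
    have "(\<phi> has_derivative (\<lambda>_. 0)) (at x)"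
    proof (rule has_derivative_transform_within_open[of "\<lambda>_. 0" _ _ _ "- closure {x. \<phi> x \<noteq> 0}"])
      show "0 = \<phi> y" if "y \<in> - closure {x. \<phi> x \<noteq> 0}" for y
        using that closure_subset[of "{x. \<phi> x \<noteq> 0}"] by auto
    qed (use that in auto)
    then show ?thesis using partial_eq by fastforce
  qed
  then have "closure {x. partial i \<phi> x \<noteq> 0} \<subseteq> closure {x. \<phi> x \<noteq> 0}"
    by (intro closure_minimal) auto
  then have "compact (closure {x. partial i \<phi> x \<noteq> 0})"
    using assms compact_Int_closed[of "closure {x. \<phi> x \<noteq> 0}" "closure {x. partial i \<phi> x \<noteq> 0}"]
    by (simp add: test_fun_def inf.absorb2)
  then show "test_fun (partial i \<phi>)"
    using smooth_D(2)[OF s, of i] by (simp add: test_fun_def smooth_def)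
  define K where "K = closure {x. \<phi> x \<noteq> 0}"
  have K: "compact K" using assms by (simp add: K_def test_fun_def)
  have c: "continuous_on UNIV \<phi>" by (rule smooth_D(3)[OF s])
  have "integrable lborel (\<lambda>x. indicator K x *\<^sub>R (norm (\<phi> x))\<^sup>2)"
    by (intro borel_integrable_compact K continuous_intros continuous_on_subset[OF c]) auto
  also have "(\<lambda>x. indicator K x *\<^sub>R (norm (\<phi> x))\<^sup>2) = (\<lambda>x. (norm (\<phi> x))\<^sup>2)"
    using closure_subset[of "{x. \<phi> x \<noteq> 0}"] by (intro ext) (auto simp: K_def indicator_def subset_iff)
  finally have "integrable lebesgue (\<lambda>x. (norm (\<phi> x))\<^sup>2)"
    using borel_measurable_continuous_onI[OF c] by (subst integrable_completion) auto
  then show "square_integrable \<phi>"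
    using continuous_borel_measurable_lebesgue[OF c] by (simp add: square_integrable_def)
qed

section \<open>Calculus of weak gradients\<close>

lemma has_weak_gradient_square_integrable:
  "has_weak_gradient f G \<Longrightarrow> square_integrable G"
  "has_weak_gradient f G \<Longrightarrow> square_integrable (\<lambda>x. G x $ i)"
  using square_integrable_vec_iff by (auto simp: has_weak_gradient_def)

lemma has_weak_gradient_D:
  "has_weak_gradient f G \<Longrightarrow> test_fun \<phi> \<Longrightarrow>
    (LINT x|lebesgue. partial i \<phi> x *\<^sub>R f x) = - (LINT x|lebesgue. \<phi> x *\<^sub>R (G x $ i))"
  by (simp add: has_weak_gradient_def)

text \<open>\<open>weak_gradient\<close> is an arbitrary choice; uniqueness is what allows the
  explicit gradients of differences, products and translates to replace it almost
  everywhere.\<close>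

lemma has_weak_gradient_unique:
  assumes G: "has_weak_gradient f G" and H: "has_weak_gradient f H"
  shows "AE x in lebesgue. G x = H x"
proof -
  have "AE x in lebesgue. G x $ i - H x $ i = 0" for i
  proof (rule AE_zero_if_test_fun_orthogonal)
    show "square_integrable (\<lambda>x. G x $ i - H x $ i)"
      by (intro square_integrable_diff has_weak_gradient_square_integrable[OF G] has_weak_gradient_square_integrable[OF H])
    fix \<phi> :: "real^3 \<Rightarrow> real" assume \<phi>: "test_fun \<phi>"
    show "(LINT x|lebesgue. \<phi> x *\<^sub>R (G x $ i - H x $ i)) = 0"
      using has_weak_gradient_D[OF G \<phi>, of i] has_weak_gradient_D[OF H \<phi>, of i]
      by (simp add: scaleR_diff_right test_fun_D[OF \<phi>] integrable_scaleR_product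
        has_weak_gradient_square_integrable[OF G] has_weak_gradient_square_integrable[OF H])
  qed
  then have "AE x in lebesgue. \<forall>i. G x $ i - H x $ i = 0" by (simp add: AE_all_countable)
  then show ?thesis by eventually_elim (simp add: vec_eq_iff)
qed

lemma has_weak_gradient_diff:
  assumes f: "square_integrable f" "has_weak_gradient f F" and g: "square_integrable g" "has_weak_gradient g G"
  shows "has_weak_gradient (\<lambda>x. f x - g x) (\<lambda>x. F x - G x)"
  unfolding has_weak_gradient_def
proof (intro conjI allI impI)
  show "square_integrable (\<lambda>x. F x - G x)"
    using f g by (auto simp: has_weak_gradient_def square_integrable_diff)
  fix \<phi> i assume \<phi>: "test_fun \<phi>"
  show "(LINT x|lebesgue. partial i \<phi> x *\<^sub>R (f x - g x)) = - (LINT x|lebesgue. \<phi> x *\<^sub>R ((F x - G x) $ i))"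
    using has_weak_gradient_D[OF f(2) \<phi>, of i] has_weak_gradient_D[OF g(2) \<phi>, of i] f g
    by (simp add: scaleR_diff_right test_fun_D[OF \<phi>] test_fun_D[OF test_fun_D(2)[OF \<phi>]] integrable_scaleR_product
        has_weak_gradient_square_integrable[OF f(2)] has_weak_gradient_square_integrable[OF g(2)])
qed

lemma square_integrable_mult:
  fixes f :: wave
  assumes "square_integrable f" "continuous_on UNIV \<phi>" "\<And>x. \<bar>\<phi> x\<bar> \<le> C"
  shows "square_integrable (\<lambda>x. \<phi> x *\<^sub>R f x)"
  using assms continuous_borel_measurable_lebesgue[OF assms(2)]
  by (intro square_integrable_bounded[OF assms(1), of _ C])
    (auto intro!: mult_right_mono borel_measurable_scaleR simp: square_integrable_def)

text \<open>Leibniz rule: for a test function \<psi> the product of \<phi> and \<psi> is again a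
  test function, so the gradient of \<open>f\<close> may be tested against it and the classical
  product rule rearranged.\<close>

lemma has_weak_gradient_mult:
  assumes f: "square_integrable f" "has_weak_gradient f F"
    and \<phi>: "smooth \<phi>" "\<And>x. \<bar>\<phi> x\<bar> \<le> C" "\<And>i x. \<bar>partial i \<phi> x\<bar> \<le> C"
  shows "has_weak_gradient (\<lambda>x. \<phi> x *\<^sub>R f x) (\<lambda>x. \<chi> i. \<phi> x *\<^sub>R (F x $ i) + partial i \<phi> x *\<^sub>R f x)"
  unfolding has_weak_gradient_def
proof (intro conjI allI impI)
  note c = smooth_D(3)[OF \<phi>(1)] smooth_D(3)[OF smooth_D(2)[OF \<phi>(1)]]
  have sq: "square_integrable (\<lambda>x. \<phi> x *\<^sub>R (F x $ i))" "square_integrable (\<lambda>x. partial i \<phi> x *\<^sub>R f x)" for i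
    using c \<phi> f has_weak_gradient_square_integrable[OF f(2)] by (auto intro!: square_integrable_mult)
  then show "square_integrable (\<lambda>x. \<chi> i. \<phi> x *\<^sub>R (F x $ i) + partial i \<phi> x *\<^sub>R f x)"
    by (auto simp: square_integrable_vec_iff intro!: square_integrable_add)
  fix \<psi> i assume \<psi>: "test_fun \<psi>"
  have t: "test_fun (\<lambda>x. \<phi> x * \<psi> x)" by (rule test_fun_mult[OF \<phi>(1) \<psi>])
  have p: "partial i (\<lambda>x. \<phi> x * \<psi> x) x = \<phi> x * partial i \<psi> x + partial i \<phi> x * \<psi> x" for x
    by (intro partial_mult smooth_D(1) \<phi> test_fun_D(1)[OF \<psi>])
  note i1 = integrable_scaleR_product[OF test_fun_D(3)[OF \<psi>] sq(1)[of i]]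
  note i2 = integrable_scaleR_product[OF test_fun_D(3)[OF \<psi>] sq(2)[of i]]
  note i3 = integrable_scaleR_product[OF test_fun_D(3)[OF test_fun_D(2)[OF t]] f(1), of i]
  have "(LINT x|lebesgue. partial i \<psi> x *\<^sub>R \<phi> x *\<^sub>R f x)
      = (LINT x|lebesgue. partial i (\<lambda>x. \<phi> x * \<psi> x) x *\<^sub>R f x - \<psi> x *\<^sub>R partial i \<phi> x *\<^sub>R f x)"
    by (intro Bochner_Integration.integral_cong) (auto simp: p algebra_simps)
  also have "\<dots> = - (LINT x|lebesgue. \<psi> x *\<^sub>R \<phi> x *\<^sub>R (F x $ i)) - (LINT x|lebesgue. \<psi> x *\<^sub>R partial i \<phi> x *\<^sub>R f x)"
    using has_weak_gradient_D[OF f(2) t, of i] i2 i3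
    by (simp add: mult.commute[of "\<phi> _"])
  also have "\<dots> = - (LINT x|lebesgue. \<psi> x *\<^sub>R ((\<chi> i. \<phi> x *\<^sub>R (F x $ i) + partial i \<phi> x *\<^sub>R f x) $ i))"
    using i1 i2 by (simp add: scaleR_add_right)
  finally show "(LINT x|lebesgue. partial i \<psi> x *\<^sub>R \<phi> x *\<^sub>R f x)
      = - (LINT x|lebesgue. \<psi> x *\<^sub>R ((\<chi> i. \<phi> x *\<^sub>R (F x $ i) + partial i \<phi> x *\<^sub>R f x) $ i))" .
qed

lemma square_integrable_translate:
  assumes "square_integrable f" shows "square_integrable (\<lambda>x. f (x + a))"
proof -
  have [measurable]: "f \<in> borel_measurable lebesgue" using assms by (simp add: square_integrable_def)
  have "(\<lambda>x. (norm (f x))\<^sup>2) \<in> borel_measurable lebesgue" by simp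
  with assms show ?thesis
    using lebesgue_integral_translate(1)[of f a] lebesgue_integral_translate(3)[of "\<lambda>x. (norm (f x))\<^sup>2" a]
    by (simp add: square_integrable_def)
qed

text \<open>The translation is moved onto the test function by a change of variables.\<close>

lemma has_weak_gradient_translate:
  assumes f: "square_integrable f" "has_weak_gradient f F"
  shows "has_weak_gradient (\<lambda>x. f (x + a)) (\<lambda>x. F (x + a))"
  unfolding has_weak_gradient_def
proof (intro conjI allI impI)
  show "square_integrable (\<lambda>x. F (x + a))"
    using f by (simp add: has_weak_gradient_def square_integrable_translate)
  fix \<phi> i assume \<phi>: "test_fun \<phi>"
  let ?\<psi> = "\<lambda>x. \<phi> (x + - a)"
  have \<psi>: "test_fun ?\<psi>" by (rule test_fun_translate[OF \<phi>])
  have p: "partial i ?\<psi> (x + a) = partial i \<phi> x" for x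
    using partial_translate(2)[of \<phi> "x + a" "-a" i] smooth_D(1)[OF test_fun_D(1)[OF \<phi>]] by simp
  note m = integrable_scaleR_product[OF test_fun_D(3)[OF test_fun_D(2)[OF \<psi>]] f(1), of i, THEN borel_measurable_integrable]
    integrable_scaleR_product[OF test_fun_D(3)[OF \<psi>] has_weak_gradient_square_integrable(2)[OF f(2)], of i, THEN borel_measurable_integrable]
  show "(LINT x|lebesgue. partial i \<phi> x *\<^sub>R f (x + a)) = - (LINT x|lebesgue. \<phi> x *\<^sub>R (F (x + a) $ i))"
    using lebesgue_integral_translate(2)[OF m(1), of a] lebesgue_integral_translate(2)[OF m(2), of a]
      has_weak_gradient_D[OF f(2) \<psi>, of i]
    by (simp only: p) simp
qed

section \<open>Compactness in \<open>H\<^sup>1\<close>\<close>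

lemma H1_D:
  assumes "f \<in> H1"
  shows "square_integrable f" "has_weak_gradient f (weak_gradient f)"
  using assms someI_ex[of "has_weak_gradient f"] by (auto simp: H1_def weak_gradient_def)

lemma H1_I: "square_integrable f \<Longrightarrow> has_weak_gradient f G \<Longrightarrow> f \<in> H1"
  by (auto simp: H1_def)

lemma weak_gradient_AE_eq:
  assumes "has_weak_gradient f G"
  shows "AE x in lebesgue. weak_gradient f x = G x"
  using has_weak_gradient_unique[OF _ assms] someI[of "has_weak_gradient f", OF assms]
  by (simp add: weak_gradient_def)

text \<open>The integrand of the squared \<open>H1_norm\<close>. Keeping function and gradient
  together makes both tight at once, and it dominates twice the product of their norms, hence the
  mass flux.\<close>

definition energy_density :: "wave \<Rightarrow> real^3 \<Rightarrow> real" where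
  "energy_density f x = (norm (f x))\<^sup>2 + (norm (weak_gradient f x))\<^sup>2"

lemma energy_density_nonneg: "0 \<le> energy_density f x"
  by (simp add: energy_density_def)

lemma integrable_energy_density:
  assumes "f \<in> H1" shows "integrable lebesgue (energy_density f)"
  using H1_D(1)[OF assms] has_weak_gradient_square_integrable(1)[OF H1_D(2)[OF assms]]
  unfolding energy_density_def[abs_def] square_integrable_def by simp

lemma energy_density_AE_eq:
  assumes "has_weak_gradient f G"
  shows "AE x in lebesgue. energy_density f x = (norm (f x))\<^sup>2 + (norm (G x))\<^sup>2"
  using weak_gradient_AE_eq[OF assms] by eventually_elim (simp add: energy_density_def)

lemma H1_norm_eq:
  assumes "f \<in> H1"
  shows "(H1_norm f)\<^sup>2 = (LINT x|lebesgue. energy_density f x)" "H1_norm f \<ge> 0"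
  using H1_D(1)[OF assms] has_weak_gradient_square_integrable(1)[OF H1_D(2)[OF assms]]
  by (simp_all add: H1_norm_def energy_density_def square_integrable_def)

text \<open>Even for the zero function \<open>weak_gradient\<close> is only some choice; its norm
  vanishes because that choice agrees almost everywhere with 0.\<close>

lemma H1_zero: "(\<lambda>x. 0) \<in> H1" "H1_norm (\<lambda>x. 0) = 0"
proof -
  have w: "has_weak_gradient (\<lambda>x. 0) (\<lambda>x. 0)"
    by (auto simp: has_weak_gradient_def square_integrable_def)
  show H: "(\<lambda>x. 0) \<in> H1" by (rule H1_I[OF _ w]) (simp add: square_integrable_def)
  have "(LINT x|lebesgue. energy_density (\<lambda>x. 0) x) = (LINT x|(lebesgue :: (real^3) measure). 0)"
    using energy_density_AE_eq[OF w] borel_measurable_integrable[OF integrable_energy_density[OF H]]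
    by (intro integral_cong_AE) auto
  then show "H1_norm (\<lambda>x. 0) = 0"
    using H1_norm_eq[OF H] by simp
qed

lemma H1_diff: "f \<in> H1 \<Longrightarrow> g \<in> H1 \<Longrightarrow> (\<lambda>x. f x - g x) \<in> H1"
  by (blast intro: H1_I H1_D square_integrable_diff has_weak_gradient_diff)

lemma H1_translate: "f \<in> H1 \<Longrightarrow> (\<lambda>x. f (x + a)) \<in> H1"
  by (blast intro: H1_I H1_D square_integrable_translate has_weak_gradient_translate)

section \<open>Finite nets, tightness and boundedness of precompact sets\<close>

lemma topspace_H1: "topspace H1_topology = H1"
  unfolding H1_topology_def topology_generated_by_topspace
proof (intro equalityI subsetI)
  fix f assume "f \<in> H1"
  then have "f \<in> {g \<in> H1. H1_norm (\<lambda>x. g x - f x) < 1}" by (simp add: H1_zero)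
  with \<open>f \<in> H1\<close> zero_less_one show "f \<in> \<Union> {{g \<in> H1. H1_norm (\<lambda>x. g x - f x) < r} | f r. f \<in> H1 \<and> r > 0}"
    by blast
qed auto

lemma openin_H1_ball: "f \<in> H1 \<Longrightarrow> r > 0 \<Longrightarrow> openin H1_topology {g \<in> H1. H1_norm (\<lambda>x. g x - f x) < r}"
  unfolding H1_topology_def by (rule topology_generated_by_Basis) blast

text \<open>The closure is covered by balls centred at all points of \<open>H1\<close>, each point
  lying in its own ball; a finite subcover supplies the centres, which need not belong to
  \<open>S\<close>.\<close>

lemma H1_precompact_net:
  assumes "compactin H1_topology (H1_topology closure_of S)" "S \<subseteq> H1" "\<epsilon> > 0"
  obtains F where "finite F" "F \<subseteq> H1" "\<And>g. g \<in> S \<Longrightarrow> \<exists>f\<in>F. H1_norm (\<lambda>x. g x - f x) < \<epsilon>"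
proof -
  define b where "b f = {g \<in> H1. H1_norm (\<lambda>x. g x - f x) < \<epsilon>}" for f
  have "H1_topology closure_of S \<subseteq> \<Union> (b ` H1)"
  proof
    fix f assume "f \<in> H1_topology closure_of S"
    then have "f \<in> H1" using closure_of_subset_topspace[of H1_topology S] by (auto simp: topspace_H1)
    then show "f \<in> \<Union> (b ` H1)" using \<open>\<epsilon> > 0\<close> by (auto simp: b_def H1_zero intro!: bexI[of _ f])
  qed
  moreover have "\<forall>U\<in>b ` H1. openin H1_topology U"
    using openin_H1_ball \<open>\<epsilon> > 0\<close> by (auto simp: b_def)
  ultimately obtain \<F> where \<F>: "finite \<F>" "\<F> \<subseteq> b ` H1" "H1_topology closure_of S \<subseteq> \<Union> \<F>"
    using assms(1) unfolding compactin_def by meson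
  then obtain F where F: "finite F" "F \<subseteq> H1" "\<F> = b ` F"
    by (meson finite_subset_image)
  have "S \<subseteq> H1_topology closure_of S" by (rule closure_of_subset) (simp add: topspace_H1 assms)
  then have "\<exists>f\<in>F. H1_norm (\<lambda>x. g x - f x) < \<epsilon>" if "g \<in> S" for g
    using \<F>(3) F(3) that by (auto simp: b_def)
  with F that show ?thesis by blast
qed

lemma integrable_indicator_energy_density:
  assumes "f \<in> H1" "S \<in> sets lebesgue"
  shows "integrable lebesgue (\<lambda>x. indicator S x * energy_density f x)"
  using integrable_mult_indicator[OF assms(2) integrable_energy_density[OF assms(1)]] by simp

text \<open>A localized substitute for the triangle inequality: \<open>g\<close> is split as
  \<open>f\<close> plus \<open>g - f\<close> pointwise, and only the part from \<open>f\<close>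
  keeps the restriction to \<open>S\<close>.\<close>

lemma energy_on_set_le:
  assumes f: "f \<in> H1" and g: "g \<in> H1" and S: "S \<in> sets lebesgue"
  shows "(LINT x|lebesgue. indicator S x * energy_density g x)
      \<le> 2 * ((LINT x|lebesgue. indicator S x * energy_density f x) + (H1_norm (\<lambda>x. g x - f x))\<^sup>2)"
proof -
  let ?h = "\<lambda>x. g x - f x"
  have h: "?h \<in> H1" by (rule H1_diff[OF g f])
  have "AE x in lebesgue. indicator S x * energy_density g x
      \<le> 2 * (indicator S x * energy_density f x + energy_density ?h x)"
    using energy_density_AE_eq[OF has_weak_gradient_diff[OF H1_D[OF g] H1_D[OF f]]]
  proof eventually_elim
    fix x assume *: "energy_density ?h x = (norm (g x - f x))\<^sup>2 + (norm (weak_gradient g x - weak_gradient f x))\<^sup>2"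
    have "energy_density g x \<le> 2 * (energy_density f x + energy_density ?h x)"
      using power2_norm_add_le[of "f x" "g x - f x"]
        power2_norm_add_le[of "weak_gradient f x" "weak_gradient g x - weak_gradient f x"]
      by (simp add: * energy_density_def[of f] energy_density_def[of g])
    then show "indicator S x * energy_density g x \<le> 2 * (indicator S x * energy_density f x + energy_density ?h x)"
      using energy_density_nonneg[of ?h x] by (auto simp: indicator_def)
  qed
  then have "(LINT x|lebesgue. indicator S x * energy_density g x)
      \<le> (LINT x|lebesgue. 2 * (indicator S x * energy_density f x + energy_density ?h x))"
    using integrable_indicator_energy_density[OF f S] integrable_indicator_energy_density[OF g S]
      integrable_energy_density[OF h]
    by (intro integral_mono_AE) auto
  also have "\<dots> = 2 * ((LINT x|lebesgue. indicator S x * energy_density f x) + (H1_norm ?h)\<^sup>2)"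
    using integrable_indicator_energy_density[OF f S] integrable_energy_density[OF h] H1_norm_eq(1)[OF h]
    by simp
  finally show ?thesis .
qed

lemma exterior_measurable: "{x. A \<le> norm (x + a)} \<in> sets lebesgue"
proof -
  have "closed {x. A \<le> norm (x + a)}" by (intro closed_Collect_le continuous_intros)
  then show ?thesis by (simp add: borel_closed)
qed

lemma energy_tail_tendsto:
  assumes f: "f \<in> H1"
  shows "(\<lambda>n. LINT x|lebesgue. indicator {x. real n \<le> norm x} x * energy_density f x) \<longlonglongrightarrow> 0"
proof -
  have ext: "{x. A \<le> norm x} \<in> sets lebesgue" for A using exterior_measurable[of A 0] by simp
  have "(\<lambda>n. LINT x|lebesgue. indicator {x. real n \<le> norm x} x * energy_density f x) \<longlonglongrightarrow> (LINT x|(lebesgue :: (real^3) measure). 0)"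
  proof (rule integral_dominated_convergence)
    show "integrable lebesgue (energy_density f)" by (rule integrable_energy_density[OF f])
    show "(\<lambda>x. indicator {x. real n \<le> norm x} x * energy_density f x) \<in> borel_measurable lebesgue" for n
      using integrable_indicator_energy_density[OF f ext] by (rule borel_measurable_integrable)
    show "AE x in lebesgue. norm (indicator {x. real n \<le> norm x} x * energy_density f x) \<le> energy_density f x" for n
      using energy_density_nonneg[of f] by (auto simp: indicator_def)
    show "AE x in lebesgue. (\<lambda>n. indicator {x. real n \<le> norm x} x * energy_density f x) \<longlonglongrightarrow> 0"
    proof (rule AE_I2)
      fix x :: "real^3"
      have "eventually (\<lambda>n. norm x < real n) sequentially"
        by (rule eventually_compose_filterlim[OF eventually_gt_at_top filterlim_real_sequentially])
      then show "(\<lambda>n. indicator {x. real n \<le> norm x} x * energy_density f x) \<longlonglongrightarrow> 0"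
        by (intro tendsto_eventually) (auto elim!: eventually_mono)
    qed
  qed simp
  then show ?thesis by simp
qed

text \<open>Each of the finitely many centres of a net has a small tail, so a single radius serves
  all of them, and members of \<open>S\<close> differ from a centre by little in
  \<open>H1\<close>.\<close>

lemma H1_precompact_tight:
  assumes S: "compactin H1_topology (H1_topology closure_of S)" "S \<subseteq> H1" and \<epsilon>: "\<epsilon> > 0"
  obtains A where "A > 0" "\<And>g. g \<in> S \<Longrightarrow> (LINT x|lebesgue. indicator {x. A \<le> norm x} x * energy_density g x) \<le> \<epsilon>"
proof -
  \<comment> \<open>Centre tail and squared distance get a quarter of \<epsilon> each;
    \<open>energy_on_set_le\<close> doubles their sum.\<close>
  define \<delta> where "\<delta> = sqrt (\<epsilon> / 4)"
  have \<delta>: "\<delta> > 0" "\<delta>\<^sup>2 = \<epsilon> / 4" using \<epsilon> by (auto simp: \<delta>_def)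
  obtain F where F: "finite F" "F \<subseteq> H1" "\<And>g. g \<in> S \<Longrightarrow> \<exists>f\<in>F. H1_norm (\<lambda>x. g x - f x) < \<delta>"
    by (rule H1_precompact_net[OF S \<delta>(1)]) blast
  have "\<forall>f\<in>F. eventually (\<lambda>n. (LINT x|lebesgue. indicator {x. real n \<le> norm x} x * energy_density f x) < \<epsilon> / 4) sequentially"
    using F(2) \<epsilon> by (intro ballI order_tendstoD(2)[OF energy_tail_tendsto]) auto
  then have "eventually (\<lambda>n. \<forall>f\<in>F. (LINT x|lebesgue. indicator {x. real n \<le> norm x} x * energy_density f x) < \<epsilon> / 4) sequentially"
    by (rule eventually_ball_finite[OF F(1)])
  then obtain n where n: "n > 0" "\<And>f. f \<in> F \<Longrightarrow> (LINT x|lebesgue. indicator {x. real n \<le> norm x} x * energy_density f x) < \<epsilon> / 4"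
    using eventually_happens[OF eventually_conj[OF _ eventually_gt_at_top[of "0::nat"]]] sequentially_bot by blast
  have "(LINT x|lebesgue. indicator {x. real n \<le> norm x} x * energy_density g x) \<le> \<epsilon>" if g: "g \<in> S" for g
  proof -
    obtain f where f: "f \<in> F" "H1_norm (\<lambda>x. g x - f x) < \<delta>" using F(3)[OF g] by blast
    have H: "f \<in> H1" "g \<in> H1" using f F(2) g S(2) by auto
    have "(H1_norm (\<lambda>x. g x - f x))\<^sup>2 \<le> \<epsilon> / 4"
      using power_mono[of "H1_norm (\<lambda>x. g x - f x)" \<delta> 2] f(2) H1_norm_eq(2)[OF H1_diff[OF H(2,1)]] \<delta>(2) by simp
    then show ?thesis
      using energy_on_set_le[OF H exterior_measurable[of "real n" 0]] n(2)[OF f(1)] by simp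
  qed
  then show ?thesis using that[of "real n"] n(1) by simp
qed

lemma H1_precompact_bounded:
  assumes S: "compactin H1_topology (H1_topology closure_of S)" "S \<subseteq> H1"
  obtains B where "B > 0" "\<And>g. g \<in> S \<Longrightarrow> (LINT x|lebesgue. energy_density g x) \<le> B"
proof -
  obtain F where F: "finite F" "F \<subseteq> H1" "\<And>g. g \<in> S \<Longrightarrow> \<exists>f\<in>F. H1_norm (\<lambda>x. g x - f x) < 1"
    by (rule H1_precompact_net[OF S zero_less_one]) blast
  \<comment> \<open>The sum over the net stands in for a maximum; the added 1 is the squared radius
    and keeps \<open>B\<close> positive even if the net is empty.\<close>
  define B where "B = 2 * ((\<Sum>f\<in>F. LINT x|lebesgue. energy_density f x) + 1)"
  have nn: "0 \<le> (LINT x|lebesgue. energy_density f x)" for f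
    by (simp add: integral_nonneg_AE energy_density_nonneg)
  have "(LINT x|lebesgue. energy_density g x) \<le> B" if g: "g \<in> S" for g
  proof -
    obtain f where f: "f \<in> F" "H1_norm (\<lambda>x. g x - f x) < 1" using F(3)[OF g] by blast
    have H: "f \<in> H1" "g \<in> H1" using f F(2) g S(2) by auto
    have "(H1_norm (\<lambda>x. g x - f x))\<^sup>2 \<le> 1"
      using f(2) H1_norm_eq(2)[OF H1_diff[OF H(2,1)]] by (simp add: power_le_one)
    moreover have "(LINT x|lebesgue. energy_density f x) \<le> (\<Sum>f\<in>F. LINT x|lebesgue. energy_density f x)"
      using F(1) f(1) nn by (intro member_le_sum) auto
    ultimately show ?thesis
      using energy_on_set_le[OF H, of UNIV] by (simp add: B_def)
  qed
  moreover have "B > 0" unfolding B_def using sum_nonneg[of F "\<lambda>f. LINT x|lebesgue. energy_density f x", OF nn] by simp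
  ultimately show ?thesis using that by blast
qed

text \<open>With \<open>a = - x t\<close> this carries bounds for the recentred profile back to
  \<open>u t\<close>, whose energy therefore sits around \<open>- x t\<close>.\<close>

lemma energy_translate:
  assumes f: "f \<in> H1" and W: "W \<in> borel_measurable lebesgue"
  shows "(LINT x|lebesgue. W x * energy_density (\<lambda>y. f (y + a)) x) = (LINT x|lebesgue. W (x - a) * energy_density f x)"
proof -
  have t: "(\<lambda>y. f (y + a)) \<in> H1" by (rule H1_translate[OF f])
  have m [measurable]: "energy_density f \<in> borel_measurable lebesgue" "energy_density (\<lambda>y. f (y + a)) \<in> borel_measurable lebesgue"
    using integrable_energy_density f t borel_measurable_integrable by blast+
  have [measurable]: "(\<lambda>x. energy_density f (x + a)) \<in> borel_measurable lebesgue" "(\<lambda>x. W (x - a)) \<in> borel_measurable lebesgue"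
    using lebesgue_integral_translate(1)[OF m(1), of a] lebesgue_integral_translate(1)[OF W, of "-a"] by auto
  have [measurable]: "W \<in> borel_measurable lebesgue" by fact
  have "AE x in lebesgue. energy_density (\<lambda>y. f (y + a)) x = energy_density f (x + a)"
    using energy_density_AE_eq[OF has_weak_gradient_translate[OF H1_D[OF f]], of a]
    by eventually_elim (simp add: energy_density_def[of f])
  then have "(LINT x|lebesgue. W x * energy_density (\<lambda>y. f (y + a)) x) = (LINT x|lebesgue. W x * energy_density f (x + a))"
    by (intro integral_cong_AE) auto
  also have "\<dots> = (LINT x|lebesgue. W (x - a) * energy_density f x)"
    using lebesgue_integral_translate(2)[of "\<lambda>x. W (x - a) * energy_density f x" a] by simp
  finally show ?thesis .
qed

section \<open>The weighted mass\<close>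

text \<open>The integral of the square of l|f| - |g| is a nonnegative quadratic polynomial in
  l.\<close>

lemma L2_Cauchy_Schwarz:
  assumes f: "square_integrable f" and g: "square_integrable g"
  shows "(LINT x|lebesgue. norm (f x) * norm (g x))\<^sup>2
    \<le> (LINT x|lebesgue. (norm (f x))\<^sup>2) * (LINT x|lebesgue. (norm (g x))\<^sup>2)"
proof -
  define a where "a = (LINT x|lebesgue. (norm (f x))\<^sup>2)"
  define b where "b = (LINT x|lebesgue. (norm (g x))\<^sup>2)"
  define c where "c = (LINT x|lebesgue. norm (f x) * norm (g x))"
  have i: "integrable lebesgue (\<lambda>x. norm (f x) * norm (g x))"
    using f g by (intro integrable_product[OF f g, where C=1]) (auto simp: square_integrable_def)
  have q: "0 \<le> l\<^sup>2 * a - 2 * l * c + b" for l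
  proof -
    have "0 \<le> (LINT x|lebesgue. (l * norm (f x) - norm (g x))\<^sup>2)"
      by (rule integral_nonneg_AE) simp
    also have "\<dots> = (LINT x|lebesgue. l\<^sup>2 * (norm (f x))\<^sup>2 - (2 * l) * (norm (f x) * norm (g x)) + (norm (g x))\<^sup>2)"
      by (intro Bochner_Integration.integral_cong) (auto simp: power2_diff power_mult_distrib algebra_simps)
    also have "\<dots> = l\<^sup>2 * a - 2 * l * c + b"
      using i f g by (simp add: a_def b_def c_def square_integrable_def)
    finally show ?thesis .
  qed
  have a0: "a \<ge> 0" by (simp add: a_def)
  show ?thesis unfolding a_def[symmetric] b_def[symmetric] c_def[symmetric]
  proof (cases "a = 0")
    case True
    have "c = 0"
    proof (rule ccontr)
      assume "c \<noteq> 0"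
      \<comment> \<open>For \<open>a = 0\<close> the polynomial is linear in l; this l gives it the
        value -1.\<close>
      with True q[of "(b + 1) / (2 * c)"] show False by (simp add: field_simps)
    qed
    with True show "c\<^sup>2 \<le> a * b" by simp
  next
    case False
    \<comment> \<open>The minimizer of the quadratic polynomial.\<close>
    with a0 q[of "c / a"] show "c\<^sup>2 \<le> a * b"
      by (simp add: field_simps power2_eq_square)
  qed
qed

lemma L2_pairing_le:
  assumes f: "f \<in> H1" and g: "g \<in> H1"
  shows "norm (L2_pairing f g) \<le> H1_norm f * H1_norm g"
proof -
  have "norm (L2_pairing f g) \<le> (LINT x|lebesgue. norm (f x * cnj (g x)))"
    unfolding L2_pairing_def by (rule integral_norm_bound)
  also have "\<dots> = (LINT x|lebesgue. norm (f x) * norm (g x))" by (simp add: norm_mult)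
  also have "\<dots> \<le> H1_norm f * H1_norm g"
  proof (rule power2_le_imp_le)
    have l: "(LINT x|lebesgue. (norm (h x))\<^sup>2) \<le> (H1_norm h)\<^sup>2" if "h \<in> H1" for h
      unfolding H1_norm_eq(1)[OF that]
      using H1_D(1)[OF that] integrable_energy_density[OF that]
      by (intro integral_mono) (auto simp: square_integrable_def, simp add: energy_density_def)
    have "(LINT x|lebesgue. norm (f x) * norm (g x))\<^sup>2 \<le> (LINT x|lebesgue. (norm (f x))\<^sup>2) * (LINT x|lebesgue. (norm (g x))\<^sup>2)"
      by (intro L2_Cauchy_Schwarz H1_D f g)
    also have "\<dots> \<le> (H1_norm f)\<^sup>2 * (H1_norm g)\<^sup>2"
      by (intro mult_mono l f g) auto
    finally show "(LINT x|lebesgue. norm (f x) * norm (g x))\<^sup>2 \<le> (H1_norm f * H1_norm g)\<^sup>2"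
      by (simp add: power_mult_distrib)
  qed (simp add: H1_norm_eq f g)
  finally show ?thesis .
qed

text \<open>Weights acting boundedly on \<open>H1\<close>. No decay is demanded, so the constant 1
  and the sine weight both qualify.\<close>

definition smooth_multiplier :: "real \<Rightarrow> (real^3 \<Rightarrow> real) \<Rightarrow> bool" where
  "smooth_multiplier C \<phi> \<longleftrightarrow> smooth \<phi> \<and> (\<forall>x. \<bar>\<phi> x\<bar> \<le> C) \<and> (\<forall>i x. \<bar>partial i \<phi> x\<bar> \<le> C)"

lemma H1_mult:
  assumes f: "f \<in> H1" and \<phi>: "smooth_multiplier C \<phi>"
  shows "(\<lambda>x. \<phi> x *\<^sub>R f x) \<in> H1" "H1_norm (\<lambda>x. \<phi> x *\<^sub>R f x) \<le> 3 * C * H1_norm f"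
proof -
  let ?G = "\<lambda>x. \<chi> i. \<phi> x *\<^sub>R (weak_gradient f x $ i) + partial i \<phi> x *\<^sub>R f x"
  let ?p = "\<lambda>x. \<phi> x *\<^sub>R f x"
  have s: "smooth \<phi>" and b: "\<bar>\<phi> x\<bar> \<le> C" "\<bar>partial i \<phi> x\<bar> \<le> C" for i x
    using \<phi> by (auto simp: smooth_multiplier_def)
  have C: "C \<ge> 0" using b(1)[of 0] by simp
  have w: "has_weak_gradient ?p ?G" using has_weak_gradient_mult[OF H1_D[OF f] s b] .
  show H: "?p \<in> H1"
    using H1_I[OF square_integrable_mult[OF H1_D(1)[OF f] smooth_D(3)[OF s] b(1)] w] .
  have "AE x in lebesgue. energy_density ?p x \<le> 9 * C\<^sup>2 * energy_density f x"
    using energy_density_AE_eq[OF w]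
  proof eventually_elim
    fix x assume e: "energy_density ?p x = (norm (?p x))\<^sup>2 + (norm (?G x))\<^sup>2"
    have 1: "(norm (c *\<^sub>R z))\<^sup>2 \<le> C\<^sup>2 * (norm z)\<^sup>2" if "\<bar>c\<bar> \<le> C" for c and z :: complex
      using power_mono[OF that, of 2] by (simp add: power_mult_distrib mult_right_mono)
    have "(norm (?G x))\<^sup>2 \<le> (\<Sum>i\<in>UNIV. 2 * (C\<^sup>2 * (norm (weak_gradient f x $ i))\<^sup>2 + C\<^sup>2 * (norm (f x))\<^sup>2))"
      unfolding norm_vec_power2 vec_lambda_beta
      by (intro sum_mono order_trans[OF power2_norm_add_le] mult_left_mono add_mono 1 b) auto
    also have "\<dots> = 2 * C\<^sup>2 * ((norm (weak_gradient f x))\<^sup>2 + 3 * (norm (f x))\<^sup>2)"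
      unfolding norm_vec_power2 by (simp add: sum.distrib sum_distrib_left algebra_simps)
    finally have "energy_density ?p x \<le> C\<^sup>2 * (norm (f x))\<^sup>2 + 2 * C\<^sup>2 * ((norm (weak_gradient f x))\<^sup>2 + 3 * (norm (f x))\<^sup>2)"
      using 1[OF b(1), of x "f x"] e by simp
    also have "\<dots> = C\<^sup>2 * (7 * (norm (f x))\<^sup>2 + 2 * (norm (weak_gradient f x))\<^sup>2)"
      by (simp add: algebra_simps)
    \<comment> \<open>Both 7 and 2 are rounded up to the square 9, which produces the factor 3 in
      the norm bound.\<close>
    also have "\<dots> \<le> C\<^sup>2 * (9 * energy_density f x)"
      unfolding energy_density_def by (intro mult_left_mono) auto
    finally show "energy_density ?p x \<le> 9 * C\<^sup>2 * energy_density f x" by (simp add: mult_ac)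
  qed
  then have "(LINT x|lebesgue. energy_density ?p x) \<le> (LINT x|lebesgue. 9 * C\<^sup>2 * energy_density f x)"
    using integrable_energy_density H f by (intro integral_mono_AE) auto
  then have "(H1_norm ?p)\<^sup>2 \<le> (3 * C * H1_norm f)\<^sup>2"
    by (simp add: H1_norm_eq H f power_mult_distrib)
  then show "H1_norm ?p \<le> 3 * C * H1_norm f"
    by (rule power2_le_imp_le) (use C H1_norm_eq(2)[OF f] in auto)
qed

lemma NLS_solution_H1: "NLS_solution u \<Longrightarrow> t \<ge> 0 \<Longrightarrow> u t \<in> H1"
  unfolding NLS_solution_def using continuous_map_image_subset_topspace[of "top_of_set {0..}" H1_topology u]
  by (auto simp: topspace_H1)

lemma NLS_solution_continuous:
  assumes u: "NLS_solution u" and t: "t \<ge> 0" and r: "r > 0"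
  shows "\<forall>\<^sub>F s in at t within {0..}. s \<ge> 0 \<and> H1_norm (\<lambda>x. u s x - u t x) < r"
proof -
  have ut: "u t \<in> H1" by (rule NLS_solution_H1[OF u t])
  have "openin (top_of_set {0..}) {s \<in> topspace (top_of_set {0..}). u s \<in> {g \<in> H1. H1_norm (\<lambda>x. g x - u t x) < r}}"
    using u openin_H1_ball[OF ut r] unfolding NLS_solution_def by (blast intro: openin_continuous_map_preimage)
  then obtain T where T: "open T" "{s \<in> {0..}. u s \<in> H1 \<and> H1_norm (\<lambda>x. u s x - u t x) < r} = {0..} \<inter> T"
    by (auto simp: openin_open)
  have "t \<in> {0..} \<inter> T" unfolding T(2)[symmetric] using t ut r by (simp add: H1_zero)
  moreover have "s \<ge> 0 \<and> H1_norm (\<lambda>x. u s x - u t x) < r" if "s \<in> {0..} \<inter> T" for s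
    using that unfolding T(2)[symmetric] by simp
  ultimately show ?thesis
    unfolding eventually_at_topological using T(1) by blast
qed

text \<open>Boundedness of \<open>L\<close> is read off a single difference quotient; in this way the Sobolev embedding,
  which would bound the cubic term, is avoided.\<close>

lemma Hm1_derivative_bounded:
  assumes L: "has_Hm1_derivative u L t" and u: "\<And>s. s \<ge> 0 \<Longrightarrow> u s \<in> H1" and t: "t \<ge> 0"
  obtains C where "C \<ge> 0" "\<And>\<phi>. \<phi> \<in> H1 \<Longrightarrow> norm (L \<phi>) \<le> C * H1_norm \<phi>"
proof -
  have "\<forall>\<^sub>F s in at t within {0..}. s \<ge> 0 \<and> s \<noteq> t \<and> (\<forall>\<phi>\<in>H1.
        norm (L2_pairing (\<lambda>x. u s x - u t x) \<phi> - of_real (s - t) * L \<phi>) \<le> 1 * \<bar>s - t\<bar> * H1_norm \<phi>)"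
    using L[unfolded has_Hm1_derivative_def, rule_format, OF zero_less_one]
    by (intro eventually_conj) (auto simp: eventually_at_filter)
  moreover have "{t<..} \<subseteq> {0..} - {t}" using t by auto
  then have "t \<in> closure ({0..} - {t})" using closure_mono[of "{t<..}" "{0..} - {t}"] by auto
  then have "at t within {0..} \<noteq> bot" by (simp add: at_within_eq_bot_iff)
  ultimately obtain s where s: "s \<ge> 0" "s \<noteq> t" and
    b: "\<And>\<phi>. \<phi> \<in> H1 \<Longrightarrow> norm (L2_pairing (\<lambda>x. u s x - u t x) \<phi> - of_real (s - t) * L \<phi>) \<le> \<bar>s - t\<bar> * H1_norm \<phi>"
    using eventually_happens by fastforce
  let ?w = "\<lambda>x. u s x - u t x"
  have w: "?w \<in> H1" using u s t by (intro H1_diff)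
  have "norm (L \<phi>) \<le> (1 + H1_norm ?w / \<bar>s - t\<bar>) * H1_norm \<phi>" if \<phi>: "\<phi> \<in> H1" for \<phi>
  proof -
    have "\<bar>s - t\<bar> * norm (L \<phi>) = norm (of_real (s - t) * L \<phi>)" by (simp only: norm_mult norm_of_real)
    also have "\<dots> \<le> norm (L2_pairing ?w \<phi>) + norm (L2_pairing ?w \<phi> - of_real (s - t) * L \<phi>)"
      by (metis norm_triangle_sub norm_minus_commute)
    also have "\<dots> \<le> H1_norm ?w * H1_norm \<phi> + \<bar>s - t\<bar> * H1_norm \<phi>"
      by (intro add_mono L2_pairing_le w \<phi> b)
    finally show ?thesis using s by (simp add: field_simps)
  qed
  moreover have "1 + H1_norm ?w / \<bar>s - t\<bar> \<ge> 0" using H1_norm_eq(2)[OF w] by simp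
  ultimately show ?thesis using that by blast
qed

text \<open>The imaginary part is the momentum density paired with the gradient of \<phi>, that is,
  half the mass flux seen by the weight.\<close>

definition current :: "(real^3 \<Rightarrow> real) \<Rightarrow> wave \<Rightarrow> complex" where
  "current \<phi> f = (LINT x|lebesgue. (\<Sum>i\<in>UNIV. partial i \<phi> x *\<^sub>R (weak_gradient f x $ i * cnj (f x))))"

text \<open>Local mass conservation in weak form: the equation is tested with \<phi> u(t), and the
  H^-1 derivative of u is transferred to a quadratic functional by expanding around u(t).\<close>

lemma has_real_derivative_weighted_mass:
  assumes u: "NLS_solution u" and t: "t \<ge> 0" and \<phi>: "smooth_multiplier C \<phi>"
  shows "((\<lambda>s. LINT x|lebesgue. \<phi> x * (cmod (u s x))\<^sup>2) has_real_derivative 2 * Im (current \<phi> (u t))) (at t within {0..})"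
proof -
  have uH: "u s \<in> H1" if "s \<ge> 0" for s by (rule NLS_solution_H1[OF u that])
  have s\<phi>: "smooth \<phi>" and b: "\<bar>\<phi> x\<bar> \<le> C" "\<bar>partial i \<phi> x\<bar> \<le> C" for i x
    using \<phi> by (auto simp: smooth_multiplier_def)
  have C: "C \<ge> 0" using b(1)[of 0] by simp
  have [measurable]: "\<phi> \<in> borel_measurable lebesgue"
    using continuous_borel_measurable_lebesgue[OF smooth_D(3)[OF s\<phi>]] .
  obtain L where L: "has_Hm1_derivative u L t" and eq:
    "\<And>\<psi>. \<psi> \<in> H1 \<Longrightarrow> \<i> * L \<psi> + laplacian_pairing (u t) \<psi> + L2_pairing (\<lambda>x. of_real ((cmod (u t x))\<^sup>2) * u t x) \<psi> = 0"
    using u t unfolding NLS_solution_def by blast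
  obtain K where K: "K \<ge> 0" "\<And>\<psi>. \<psi> \<in> H1 \<Longrightarrow> norm (L \<psi>) \<le> K * H1_norm \<psi>"
    using Hm1_derivative_bounded[OF L uH t] by blast
  define \<psi> where "\<psi> = (\<lambda>x. \<phi> x *\<^sub>R u t x)"
  have \<psi>: "\<psi> \<in> H1" unfolding \<psi>_def by (rule H1_mult[OF uH[OF t] \<phi>])
  let ?G = "weak_gradient (u t)"
  note hD = H1_D[OF uH[OF t]]
  note sG = has_weak_gradient_square_integrable(2)[OF hD(2)]
  \<comment> \<open>By Leibniz the Laplacian pairing with \<psi> is minus a real integral minus the
    current; the cubic pairing is real.\<close>
  have Re_L: "Re (L \<psi>) = Im (current \<phi> (u t))"
  proof -
    have i1: "integrable lebesgue (\<lambda>x. \<phi> x * (norm (?G x))\<^sup>2)"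
      using has_weak_gradient_square_integrable(1)[OF hD(2)] b(1)
      by (intro integrable_product[where C=C, of ?G ?G])
        (auto simp: square_integrable_def abs_mult power2_eq_square intro!: mult_right_mono)
    have i2: "integrable lebesgue (\<lambda>x. partial i \<phi> x *\<^sub>R (?G x $ i * cnj (u t x)))" for i
    proof (rule integrable_product[where C=C, OF sG[of i] hD(1)])
      have "partial i \<phi> \<in> borel_measurable lebesgue"
        using continuous_borel_measurable_lebesgue[OF smooth_D(3)[OF smooth_D(2)[OF s\<phi>]]] .
      then show "(\<lambda>x. partial i \<phi> x *\<^sub>R (?G x $ i * cnj (u t x))) \<in> borel_measurable lebesgue"
        using integrable_cnj_product[OF sG[of i] hD(1)] by (intro borel_measurable_scaleR) auto
    qed (auto simp: norm_mult intro!: mult_right_mono b)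
    have m: "weak_gradient \<psi> \<in> borel_measurable lebesgue" "?G \<in> borel_measurable lebesgue" "u t \<in> borel_measurable lebesgue"
      using has_weak_gradient_square_integrable(1)[OF H1_D(2)[OF \<psi>]] has_weak_gradient_square_integrable(1)[OF hD(2)] hD(1)
      by (auto simp: square_integrable_def)
    have "laplacian_pairing (u t) \<psi> = - (LINT x|lebesgue. of_real (\<phi> x * (norm (?G x))\<^sup>2)
        + (\<Sum>i\<in>UNIV. partial i \<phi> x *\<^sub>R (?G x $ i * cnj (u t x))))"
      unfolding laplacian_pairing_def
    proof (intro arg_cong[where f=uminus] integral_cong_AE)
      show "(\<lambda>x. \<Sum>i\<in>UNIV. ?G x $ i * cnj (weak_gradient \<psi> x $ i)) \<in> borel_measurable lebesgue"
        using m by (intro borel_measurable_sum borel_measurable_times borel_measurable_cnj) (auto simp: vec_borel_measurable_iff)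
      show "(\<lambda>x. complex_of_real (\<phi> x * (norm (?G x))\<^sup>2) + (\<Sum>i\<in>UNIV. partial i \<phi> x *\<^sub>R (?G x $ i * cnj (u t x)))) \<in> borel_measurable lebesgue"
        by (intro borel_measurable_add borel_measurable_sum borel_measurable_integrable[OF i2]
            borel_measurable_integrable[OF integrable_of_real[OF i1]])
      show "AE x in lebesgue. (\<Sum>i\<in>UNIV. ?G x $ i * cnj (weak_gradient \<psi> x $ i))
        = complex_of_real (\<phi> x * (norm (?G x))\<^sup>2) + (\<Sum>i\<in>UNIV. partial i \<phi> x *\<^sub>R (?G x $ i * cnj (u t x)))"
        using weak_gradient_AE_eq[OF has_weak_gradient_mult[OF hD s\<phi> b, folded \<psi>_def]]
      proof eventually_elim
        fix x assume *: "weak_gradient \<psi> x = (\<chi> i. \<phi> x *\<^sub>R (?G x $ i) + partial i \<phi> x *\<^sub>R u t x)"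
        have "complex_of_real (\<phi> x * (norm (?G x))\<^sup>2) = (\<Sum>i\<in>UNIV. \<phi> x *\<^sub>R (?G x $ i * cnj (?G x $ i)))"
          by (simp add: norm_vec_power2 complex_norm_square scaleR_conv_of_real sum_distrib_left del: of_real_power)
        then show "(\<Sum>i\<in>UNIV. ?G x $ i * cnj (weak_gradient \<psi> x $ i))
           = complex_of_real (\<phi> x * (norm (?G x))\<^sup>2) + (\<Sum>i\<in>UNIV. partial i \<phi> x *\<^sub>R (?G x $ i * cnj (u t x)))"
          by (simp add: * sum.distrib[symmetric] scaleR_conv_of_real algebra_simps)
      qed
    qed
    also have "\<dots> = - (of_real (LINT x|lebesgue. \<phi> x * (norm (?G x))\<^sup>2) + current \<phi> (u t))"
    proof -
      have "integrable lebesgue (\<lambda>x. \<Sum>i\<in>UNIV. partial i \<phi> x *\<^sub>R (?G x $ i * cnj (u t x)))"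
        using i2 by (rule Bochner_Integration.integrable_sum)
      then show ?thesis
        unfolding current_def integral_complex_of_real[symmetric]
        by (simp only: Bochner_Integration.integral_add[OF integrable_of_real[OF i1]])
    qed
    finally have lap: "laplacian_pairing (u t) \<psi> = - (of_real (LINT x|lebesgue. \<phi> x * (norm (?G x))\<^sup>2) + current \<phi> (u t))" .
    \<comment> \<open>The integral may be a junk value \<open>0\<close>, as \<open>|u|\<^sup>4\<close> is not known to be integrable; only its reality matters.\<close>
    have "L2_pairing (\<lambda>x. of_real ((cmod (u t x))\<^sup>2) * u t x) \<psi> = of_real (LINT x|lebesgue. \<phi> x * (cmod (u t x))\<^sup>2 * (cmod (u t x))\<^sup>2)"
      unfolding L2_pairing_def integral_complex_of_real[symmetric]
    proof (intro Bochner_Integration.integral_cong refl)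
      fix x
      have "of_real ((cmod (u t x))\<^sup>2) * u t x * cnj (\<psi> x) = of_real (\<phi> x) * of_real ((cmod (u t x))\<^sup>2) * (u t x * cnj (u t x))"
        by (simp add: \<psi>_def scaleR_conv_of_real mult_ac)
      then show "of_real ((cmod (u t x))\<^sup>2) * u t x * cnj (\<psi> x) = complex_of_real (\<phi> x * (cmod (u t x))\<^sup>2 * (cmod (u t x))\<^sup>2)"
        by (simp only: complex_norm_square[symmetric] of_real_mult)
    qed
    with eq[OF \<psi>] lap have "\<i> * L \<psi> = of_real (LINT x|lebesgue. \<phi> x * (norm (?G x))\<^sup>2) + current \<phi> (u t)
       - of_real (LINT x|lebesgue. \<phi> x * (cmod (u t x))\<^sup>2 * (cmod (u t x))\<^sup>2)"
      by (simp add: algebra_simps add_eq_0_iff)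
    \<comment> \<open>The imaginary part of \<open>\<i> * L \<psi>\<close> is
      \<open>Re (L \<psi>)\<close>, and on the right only the current is not real.\<close>
    from arg_cong[OF this, of Im] show ?thesis by simp
  qed
  define N where "N = (\<lambda>s. LINT x|lebesgue. \<phi> x * (cmod (u s x))\<^sup>2)"
  have N_diff: "N s - N t = Re (L2_pairing w (\<lambda>x. \<phi> x *\<^sub>R w x)) + 2 * Re (L2_pairing w \<psi>)"
    if s: "s \<ge> 0" and w: "w = (\<lambda>x. u s x - u t x)" for s w
  proof -
    have wH: "w \<in> H1" unfolding w by (intro H1_diff uH s t)
    have iN: "integrable lebesgue (\<lambda>x. \<phi> x * (cmod (u s x))\<^sup>2)" if "s \<ge> 0" for s
      using H1_D(1)[OF uH[OF that]] b(1)
      by (intro integrable_product[where C=C, of "u s" "u s"])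
        (auto simp: square_integrable_def abs_mult power2_eq_square intro!: mult_right_mono)
    have i: "integrable lebesgue (\<lambda>x. w x * cnj (\<phi> x *\<^sub>R w x))" "integrable lebesgue (\<lambda>x. w x * cnj (\<psi> x))"
      by (intro integrable_cnj_product H1_D(1) H1_mult(1)[OF _ \<phi>] wH \<psi>)+
    have "N s - N t = (LINT x|lebesgue. \<phi> x * (cmod (u s x))\<^sup>2 - \<phi> x * (cmod (u t x))\<^sup>2)"
      unfolding N_def using iN s t by simp
    \<comment> \<open>The identity |v + w|^2 - |v|^2 = |w|^2 + 2 Re(w conj(v)) with v =
      \<open>u t\<close>.\<close>
    also have "\<dots> = (LINT x|lebesgue. Re (w x * cnj (\<phi> x *\<^sub>R w x)) + 2 * Re (w x * cnj (\<psi> x)))"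
      unfolding cmod_power2
      by (intro Bochner_Integration.integral_cong) (auto simp: w \<psi>_def power2_eq_square algebra_simps)
    also have "\<dots> = Re (L2_pairing w (\<lambda>x. \<phi> x *\<^sub>R w x)) + 2 * Re (L2_pairing w \<psi>)"
      unfolding L2_pairing_def using i
      by (simp only: integral_Re[symmetric] Bochner_Integration.integral_add integrable_Re integral_mult_right_zero
         Bochner_Integration.integrable_mult_right)
    finally show ?thesis .
  qed
  have key: "\<forall>\<^sub>F s in at t within {0..}. \<bar>N s - N t - (s - t) * (2 * Im (current \<phi> (u t)))\<bar> \<le> e * \<bar>s - t\<bar>" if e: "e > 0" for e
  proof -
    \<comment> \<open>Linear error and quadratic remainder may each take e/2; the summands 1 keep
      the denominators positive.\<close>
    define \<epsilon> where "\<epsilon> = e / (4 * (H1_norm \<psi> + 1))"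
    define \<delta> where "\<delta> = e / (2 * ((K + \<epsilon>) * (3 * C) + 1))"
    have \<psi>0: "H1_norm \<psi> \<ge> 0" by (rule H1_norm_eq[OF \<psi>])
    have \<epsilon>: "\<epsilon> > 0" "2 * \<epsilon> * H1_norm \<psi> \<le> e / 2" using e \<psi>0 by (auto simp: \<epsilon>_def field_simps)
    have D: "(K + \<epsilon>) * (3 * C) \<ge> 0" using K(1) \<epsilon>(1) C by simp
    have \<delta>: "\<delta> > 0" "(K + \<epsilon>) * (3 * C) * \<delta> \<le> e / 2" using e D by (auto simp: \<delta>_def field_simps)
    have "\<forall>\<^sub>F s in at t within {0..}. \<forall>\<phi>\<in>H1.
        norm (L2_pairing (\<lambda>x. u s x - u t x) \<phi> - of_real (s - t) * L \<phi>) \<le> \<epsilon> * \<bar>s - t\<bar> * H1_norm \<phi>"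
      using L \<epsilon>(1) unfolding has_Hm1_derivative_def by blast
    then show ?thesis using NLS_solution_continuous[OF u t \<delta>(1)]
    proof eventually_elim
      fix s assume p: "\<forall>\<phi>\<in>H1. norm (L2_pairing (\<lambda>x. u s x - u t x) \<phi> - of_real (s - t) * L \<phi>) \<le> \<epsilon> * \<bar>s - t\<bar> * H1_norm \<phi>"
        and s: "s \<ge> 0 \<and> H1_norm (\<lambda>x. u s x - u t x) < \<delta>"
      define w where "w = (\<lambda>x. u s x - u t x)"
      have wH: "w \<in> H1" unfolding w_def using s t by (intro H1_diff uH) auto
      let ?v = "\<lambda>x. \<phi> x *\<^sub>R w x"
      have v: "?v \<in> H1" "H1_norm ?v \<le> 3 * C * H1_norm w" by (rule H1_mult[OF wH \<phi>])+
      \<comment> \<open>Cauchy-Schwarz would give only the square of the norm of \<open>w\<close>,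
        with no factor |s - t|. That factor comes from the derivative estimate, which is uniform
        over \<open>H1\<close> and so applies to \<open>?v\<close> although it varies with
        \<open>s\<close>.\<close>
      have "norm (L2_pairing w ?v) \<le> norm (of_real (s - t) * L ?v) + norm (L2_pairing w ?v - of_real (s - t) * L ?v)"
        by (rule norm_triangle_sub)
      also have "\<dots> \<le> \<bar>s - t\<bar> * (K * H1_norm ?v) + \<epsilon> * \<bar>s - t\<bar> * H1_norm ?v"
        using p v(1) K(2)[OF v(1)] by (intro add_mono) (auto simp: norm_mult w_def simp del: of_real_diff intro!: mult_left_mono)
      also have "\<dots> = \<bar>s - t\<bar> * ((K + \<epsilon>) * H1_norm ?v)" by (simp add: algebra_simps)
      also have "\<dots> \<le> \<bar>s - t\<bar> * ((K + \<epsilon>) * (3 * C * \<delta>))"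
      proof (intro mult_left_mono)
        have "3 * C * H1_norm w \<le> 3 * C * \<delta>" using s C by (intro mult_left_mono) (auto simp: w_def)
        with v(2) show "H1_norm ?v \<le> 3 * C * \<delta>" by linarith
      qed (use K(1) \<epsilon>(1) in auto)
      also have "\<dots> \<le> \<bar>s - t\<bar> * (e / 2)" using \<delta>(2) by (intro mult_left_mono) (auto simp: mult_ac)
      finally have 1: "norm (L2_pairing w ?v) \<le> \<bar>s - t\<bar> * (e / 2)" .
      have "norm (L2_pairing w \<psi> - of_real (s - t) * L \<psi>) \<le> \<epsilon> * \<bar>s - t\<bar> * H1_norm \<psi>"
        using p \<psi> by (simp add: w_def)
      with \<epsilon>(2) have 2: "2 * norm (L2_pairing w \<psi> - of_real (s - t) * L \<psi>) \<le> \<bar>s - t\<bar> * (e / 2)"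
        using mult_left_mono[OF \<epsilon>(2), of "\<bar>s - t\<bar>"] by (simp add: algebra_simps)
      have "N s - N t - (s - t) * (2 * Im (current \<phi> (u t)))
          = Re (L2_pairing w ?v) + 2 * Re (L2_pairing w \<psi> - of_real (s - t) * L \<psi>)"
        using N_diff[OF _ w_def] s by (simp add: Re_L algebra_simps)
      also have "\<bar>\<dots>\<bar> \<le> norm (L2_pairing w ?v) + 2 * norm (L2_pairing w \<psi> - of_real (s - t) * L \<psi>)"
        using abs_Re_le_cmod[of "L2_pairing w ?v"] abs_Re_le_cmod[of "L2_pairing w \<psi> - of_real (s - t) * L \<psi>"]
        by linarith
      finally show "\<bar>N s - N t - (s - t) * (2 * Im (current \<phi> (u t)))\<bar> \<le> e * \<bar>s - t\<bar>"
        using 1 2 by (simp add: algebra_simps)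
    qed
  qed
  have "(N has_derivative (\<lambda>h. h * (2 * Im (current \<phi> (u t))))) (at t within {0..})"
    unfolding has_derivative_within_alt2
    using key by (auto intro: bounded_linear_mult_left)
  then show ?thesis
    unfolding N_def has_field_derivative_def by (simp add: mult_commute_abs)
qed

section \<open>Drift of the centre\<close>

lemma abs_sin_diff_le: "\<bar>sin a - sin b\<bar> \<le> \<bar>a - b :: real\<bar>"
  using field_differentiable_bound[of UNIV sin cos 1 a b] by (auto intro: DERIV_sin)

lemma abs_cos_diff_le: "\<bar>cos a - cos b\<bar> \<le> \<bar>a - b :: real\<bar>"
  using field_differentiable_bound[of UNIV cos "\<lambda>x. - sin x" 1 a b] by (auto intro: DERIV_cos)

text \<open>The cubic Taylor remainder loses at most a sixth of |s|; one half is ample for bounding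
  the weight from below at the centre.\<close>

lemma abs_sin_ge_half:
  fixes s :: real
  assumes "\<bar>s\<bar> \<le> 1"
  shows "\<bar>s\<bar> / 2 \<le> \<bar>sin s\<bar>"
proof -
  have "(\<Sum>m<3. sin_coeff m * s ^ m) = s"
    by (simp add: numeral_3_eq_3 sin_coeff_def)
  with Maclaurin_sin_bound[of s 3] have "\<bar>sin s - s\<bar> \<le> \<bar>s\<bar> ^ 3 / 6"
    by (simp add: fact_numeral)
  moreover have "\<bar>s\<bar> ^ 3 \<le> \<bar>s\<bar>"
    using power_decreasing[of 1 3 "\<bar>s\<bar>"] assms by simp
  ultimately show ?thesis by linarith
qed

lemma smooth_multiplier_one: "smooth_multiplier 1 (\<lambda>x. 1)" "current (\<lambda>x. 1) f = 0"
proof -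
  have p: "partial i (\<lambda>x. 1) x = 0" for i x
    by (subst partial_eq[of _ "\<lambda>_. 0"]) auto
  then show "smooth_multiplier 1 (\<lambda>x. 1)" by (auto simp: smooth_multiplier_def smooth_def C_k_const)
  show "current (\<lambda>x. 1) f = 0" by (simp add: current_def p)
qed

lemma partial_sin_component:
  assumes "R \<noteq> 0"
  shows "partial i (\<lambda>x. R * sin (x $ j / R)) x = (if i = j then cos (x $ j / R) else 0)"
proof -
  have d: "((\<lambda>x. x $ j) has_derivative (\<lambda>x. x $ j)) (at x)" for x :: "real^3"
    by (rule bounded_linear_imp_has_derivative) (rule bounded_linear_vec_nth)
  have "((\<lambda>s. R * sin (s / R)) has_real_derivative cos (s / R)) (at s)" for s
    using assms by (auto intro!: derivative_eq_intros)
  from partial_compose(2)[OF _ this, of "\<lambda>x. x $ j" x i] d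
  have "partial i (\<lambda>x. R * sin (x $ j / R)) x = cos (x $ j / R) * partial i (\<lambda>x. x $ j) x"
    by (auto simp: differentiable_def)
  then show ?thesis by (simp add: partial_eq[OF d] axis_def)
qed

text \<open>Values are bounded by \<open>R\<close> and derivatives by 1, and one constant must serve
  both. It may grow with \<open>R\<close>, as the derivative formula for the weighted mass does not
  contain it.\<close>

lemma smooth_multiplier_sin:
  assumes "R > 0"
  shows "smooth_multiplier (max R 1) (\<lambda>x. R * sin (x $ j / R))"
  unfolding smooth_multiplier_def
proof (intro conjI allI)
  show "smooth (\<lambda>x. R * sin (x $ j / R))" by (rule smooth_sin_component)
  show "\<bar>R * sin (x $ j / R)\<bar> \<le> max R 1" for x
    using assms mult_left_le[OF abs_sin_le_one[of "x $ j / R"], of R] by (simp add: abs_mult le_max_iff_disj)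
  show "\<bar>partial i (\<lambda>x. R * sin (x $ j / R)) x\<bar> \<le> max R 1" for i x
    using assms abs_cos_le_one[of "x $ j / R"] by (auto simp: partial_sin_component le_max_iff_disj simp del: abs_cos_le_one)
qed

text \<open>The constant weight 1 has zero current.\<close>

lemma mass_conserved:
  assumes u: "NLS_solution u"
  obtains M where "\<And>t. t \<ge> 0 \<Longrightarrow> (LINT x|lebesgue. (cmod (u t x))\<^sup>2) = M"
proof -
  have "((\<lambda>s. LINT x|lebesgue. (cmod (u s x))\<^sup>2) has_real_derivative 0) (at t within {0..})" if "t \<in> {0..}" for t
    using has_real_derivative_weighted_mass[OF u _ smooth_multiplier_one(1), of t] that
    by (simp add: smooth_multiplier_one(2))
  from has_field_derivative_zero_constant[OF _ this]
  obtain M where "\<forall>t\<in>{0..}. (LINT x|lebesgue. (cmod (u t x))\<^sup>2) = M" by auto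
  with that show ?thesis by auto
qed

text \<open>Zero momentum allows 1 to be subtracted from the cosine. The difference is at most
  \<eta> off \<open>S\<close> and at most 2 everywhere, while twice the product of |f| and its j-th
  derivative is below the energy density.\<close>

lemma current_sin_le:
  assumes f: "f \<in> H1" "momentum f = 0" and R: "R > 0" and S: "S \<in> sets lebesgue"
    and \<eta>: "\<And>x. x \<notin> S \<Longrightarrow> \<bar>cos (x $ j / R) - 1\<bar> \<le> \<eta>" and \<eta>0: "\<eta> \<ge> 0"
  shows "\<bar>2 * Im (current (\<lambda>x. R * sin (x $ j / R)) f)\<bar>
    \<le> \<eta> * (LINT x|lebesgue. energy_density f x) + 2 * (LINT x|lebesgue. indicator S x * energy_density f x)"
proof -
  let ?G = "weak_gradient f"
  let ?p = "\<lambda>x. ?G x $ j * cnj (f x)"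
  have sG: "square_integrable (\<lambda>x. ?G x $ j)" by (rule has_weak_gradient_square_integrable(2)[OF H1_D(2)[OF f(1)]])
  have ip: "integrable lebesgue ?p" by (rule integrable_cnj_product[OF sG H1_D(1)[OF f(1)]])
  have cm: "(\<lambda>x. cos (x $ j / R)) \<in> borel_measurable lebesgue"
    using R by (intro continuous_borel_measurable_lebesgue continuous_intros) auto
  have ic: "integrable lebesgue (\<lambda>x. cos (x $ j / R) *\<^sub>R ?p x)"
  proof (rule integrable_product[where C=1, OF sG H1_D(1)[OF f(1)]])
    show "(\<lambda>x. cos (x $ j / R) *\<^sub>R ?p x) \<in> borel_measurable lebesgue"
      using ip cm by (intro borel_measurable_scaleR) auto
    show "norm (cos (x $ j / R) *\<^sub>R ?p x) \<le> 1 * (norm (?G x $ j) * norm (f x))" for x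
      using mult_right_mono[OF abs_cos_le_one[of "x $ j / R"], of "norm (?p x)"] by (simp add: norm_mult)
  qed
  have "current (\<lambda>x. R * sin (x $ j / R)) f = (LINT x|lebesgue. cos (x $ j / R) *\<^sub>R ?p x)"
    unfolding current_def
  proof (intro Bochner_Integration.integral_cong refl)
    fix x
    have "(\<Sum>i\<in>UNIV. partial i (\<lambda>x. R * sin (x $ j / R)) x *\<^sub>R (?G x $ i * cnj (f x)))
      = (\<Sum>i\<in>UNIV. if i = j then cos (x $ j / R) *\<^sub>R ?p x else 0)"
      using R by (intro sum.cong) (auto simp: partial_sin_component)
    then show "(\<Sum>i\<in>UNIV. partial i (\<lambda>x. R * sin (x $ j / R)) x *\<^sub>R (?G x $ i * cnj (f x))) = cos (x $ j / R) *\<^sub>R ?p x"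
      by simp
  qed
  moreover have "Im (LINT x|lebesgue. ?p x) = 0"
    using arg_cong[OF f(2), of "\<lambda>v. v $ j"] by (simp add: momentum_def mult.commute)
  ultimately have "Im (current (\<lambda>x. R * sin (x $ j / R)) f) = Im (LINT x|lebesgue. cos (x $ j / R) *\<^sub>R ?p x - ?p x)"
    by (simp only: Bochner_Integration.integral_diff[OF ic ip] minus_complex.sel diff_0_right)
  then have "\<bar>2 * Im (current (\<lambda>x. R * sin (x $ j / R)) f)\<bar> \<le> 2 * norm (LINT x|lebesgue. cos (x $ j / R) *\<^sub>R ?p x - ?p x)"
    using abs_Im_le_cmod[of "LINT x|lebesgue. cos (x $ j / R) *\<^sub>R ?p x - ?p x"] by simp
  also have "\<dots> \<le> 2 * (LINT x|lebesgue. norm (cos (x $ j / R) *\<^sub>R ?p x - ?p x))"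
    by (intro mult_left_mono integral_norm_bound) simp
  also have "\<dots> = (LINT x|lebesgue. 2 * norm (cos (x $ j / R) *\<^sub>R ?p x - ?p x))" by simp
  also have "\<dots> \<le> (LINT x|lebesgue. \<eta> * energy_density f x + 2 * (indicator S x * energy_density f x))"
  proof (rule integral_mono)
    show "integrable lebesgue (\<lambda>x. 2 * norm (cos (x $ j / R) *\<^sub>R ?p x - ?p x))"
      using ic ip by (intro integrable_mult_right integrable_norm Bochner_Integration.integrable_diff)
    show "integrable lebesgue (\<lambda>x. \<eta> * energy_density f x + 2 * (indicator S x * energy_density f x))"
      using integrable_energy_density[OF f(1)] integrable_indicator_energy_density[OF f(1) S] by auto
    fix x
    have g: "2 * norm (?p x) \<le> energy_density f x"
    proof -
      have "2 * norm (?p x) \<le> (norm (?G x $ j))\<^sup>2 + (norm (f x))\<^sup>2"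
        using zero_le_power2[of "norm (?G x $ j) - norm (f x)"] unfolding power2_diff by (simp add: norm_mult)
      moreover have "(norm (?G x $ j))\<^sup>2 \<le> (norm (?G x))\<^sup>2"
        by (intro power_mono Finite_Cartesian_Product.norm_nth_le) simp
      ultimately show ?thesis unfolding energy_density_def by linarith
    qed
    have k: "\<bar>cos (x $ j / R) - 1\<bar> \<le> \<eta> + 2 * indicator S x"
      using \<eta>[of x] \<eta>0 cos_ge_minus_one[of "x $ j / R"] cos_le_one[of "x $ j / R"]
      by (auto simp: indicator_def abs_le_iff simp del: cos_ge_minus_one)
    have "2 * norm (cos (x $ j / R) *\<^sub>R ?p x - ?p x) = \<bar>cos (x $ j / R) - 1\<bar> * (2 * norm (?p x))"
    proof -
      have "cos (x $ j / R) *\<^sub>R ?p x - ?p x = (cos (x $ j / R) - 1) *\<^sub>R ?p x" by (simp add: scaleR_diff_left)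
      then show ?thesis by (simp only: norm_scaleR mult.left_commute[of 2] real_norm_def)
    qed
    also have "\<dots> \<le> (\<eta> + 2 * indicator S x) * energy_density f x"
      by (intro mult_mono k g) (use \<eta>0 in auto)
    finally show "2 * norm (cos (x $ j / R) *\<^sub>R ?p x - ?p x) \<le> \<eta> * energy_density f x + 2 * (indicator S x * energy_density f x)"
      by (simp add: algebra_simps)
  qed
  also have "\<dots> = \<eta> * (LINT x|lebesgue. energy_density f x) + 2 * (LINT x|lebesgue. indicator S x * energy_density f x)"
    using integrable_energy_density[OF f(1)] integrable_indicator_energy_density[OF f(1) S] by simp
  finally show ?thesis .
qed

text \<open>The weight is 1-Lipschitz, so on the ball of radius \<open>A\<close> around
  \<open>- a\<close> it is within \<open>A\<close> of its value at the centre; elsewhere the two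
  values differ by at most \<open>2 * R\<close>.\<close>

lemma weighted_mass_sin:
  assumes f: "f \<in> H1" and R: "R > 0" and A: "A > 0"
  shows "\<bar>(LINT x|lebesgue. R * sin (x $ j / R) * (cmod (f x))\<^sup>2) - R * sin (- a $ j / R) * (LINT x|lebesgue. (cmod (f x))\<^sup>2)\<bar>
    \<le> A * (LINT x|lebesgue. (cmod (f x))\<^sup>2) + 2 * R * (LINT x|lebesgue. indicator {x. A \<le> norm (x + a)} x * energy_density f x)"
proof -
  let ?S = "{x. A \<le> norm (x + a)}" and ?s = "\<lambda>x. R * sin (x / R)"
  have i: "integrable lebesgue (\<lambda>x. (cmod (f x))\<^sup>2)" "integrable lebesgue (\<lambda>x. indicator ?S x * energy_density f x)"
    using H1_D(1)[OF f] integrable_indicator_energy_density[OF f exterior_measurable] by (auto simp: square_integrable_def)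
  have i_sin: "integrable lebesgue (\<lambda>x. ?s (x $ j) * (cmod (f x))\<^sup>2)"
  proof (rule integrable_product[where C=R, OF H1_D(1)[OF f] H1_D(1)[OF f]])
    have "(\<lambda>x :: real^3. ?s (x $ j)) \<in> borel_measurable lebesgue"
      using R by (intro continuous_borel_measurable_lebesgue continuous_intros) auto
    then show "(\<lambda>x. ?s (x $ j) * (cmod (f x))\<^sup>2) \<in> borel_measurable lebesgue"
      using borel_measurable_integrable[OF i(1)] by (rule borel_measurable_times)
    show "norm (?s (x $ j) * (cmod (f x))\<^sup>2) \<le> R * (cmod (f x) * cmod (f x))" for x
      using R mult_right_mono[OF abs_sin_le_one[of "x $ j / R"], of "cmod (f x) * cmod (f x)"]
      by (simp add: abs_mult power2_eq_square mult.assoc)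
  qed
  define d where "d = (\<lambda>x. ?s (x $ j) * (cmod (f x))\<^sup>2 - ?s (- a $ j) * (cmod (f x))\<^sup>2)"
  have i_d: "integrable lebesgue d"
    unfolding d_def by (intro Bochner_Integration.integrable_diff i_sin integrable_mult_right i(1))
  have "(LINT x|lebesgue. ?s (x $ j) * (cmod (f x))\<^sup>2) - ?s (- a $ j) * (LINT x|lebesgue. (cmod (f x))\<^sup>2)
     = (LINT x|lebesgue. d x)"
    unfolding d_def using i(1) by (subst Bochner_Integration.integral_diff[OF i_sin]) auto
  also have "\<bar>\<dots>\<bar> \<le> (LINT x|lebesgue. \<bar>d x\<bar>)"
    using integral_norm_bound[of lebesgue d] by simp
  also have "\<dots> \<le> (LINT x|lebesgue. A * (cmod (f x))\<^sup>2 + 2 * R * (indicator ?S x * energy_density f x))"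
  proof (rule integral_mono)
    show "integrable lebesgue (\<lambda>x. \<bar>d x\<bar>)" using i_d by (rule integrable_abs)
    show "integrable lebesgue (\<lambda>x. A * (cmod (f x))\<^sup>2 + 2 * R * (indicator ?S x * energy_density f x))"
      by (intro Bochner_Integration.integrable_add integrable_mult_right i)
    fix x
    have eq: "\<bar>d x\<bar> = R * \<bar>sin (x $ j / R) - sin (- a $ j / R)\<bar> * (cmod (f x))\<^sup>2"
    proof -
      have "d x = R * (sin (x $ j / R) - sin (- a $ j / R)) * (cmod (f x))\<^sup>2"
        by (simp only: d_def left_diff_distrib right_diff_distrib)
      then show ?thesis using R by (simp only: abs_mult abs_of_pos abs_power2 abs_norm_cancel power_abs[symmetric])
    qed
    show "\<bar>d x\<bar> \<le> A * (cmod (f x))\<^sup>2 + 2 * R * (indicator ?S x * energy_density f x)"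
    proof (cases "x \<in> ?S")
      case True
      have "\<bar>sin (x $ j / R) - sin (- a $ j / R)\<bar> \<le> 2"
        using abs_sin_le_one[of "x $ j / R"] abs_sin_le_one[of "- a $ j / R"] by linarith
      then have "R * \<bar>sin (x $ j / R) - sin (- a $ j / R)\<bar> * (cmod (f x))\<^sup>2 \<le> R * 2 * energy_density f x"
        using R by (intro mult_mono mult_left_mono) (auto simp: energy_density_def)
      moreover have "0 \<le> A * (cmod (f x))\<^sup>2" using A by simp
      ultimately show ?thesis using True unfolding eq by (simp add: mult_ac)
    next
      case False
      have "R * \<bar>sin (x $ j / R) - sin (- a $ j / R)\<bar> \<le> R * \<bar>x $ j / R - - a $ j / R\<bar>"
        using R by (intro mult_left_mono abs_sin_diff_le) auto
      also have "\<dots> = \<bar>(x + a) $ j\<bar>"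
        using R by (simp add: abs_divide flip: add_divide_distrib)
      also have "\<dots> \<le> A" using False component_le_norm_cart[of "x + a" j] by simp
      finally show ?thesis using False unfolding eq by (simp add: mult_right_mono)
    qed
  qed
  also have "\<dots> = A * (LINT x|lebesgue. (cmod (f x))\<^sup>2) + 2 * R * (LINT x|lebesgue. indicator ?S x * energy_density f x)"
    using i by simp
  finally show ?thesis .
qed

text \<open>The constant must not depend on \<open>T\<close>, so \<open>K\<close>, \<epsilon> and
  \<open>A\<close> are fixed first and only \<open>X\<close> and \<open>R\<close> follow
  \<open>T\<close>.\<close>

lemma sublinear_drift:
  fixes x :: "real \<Rightarrow> real^3"
  assumes u: "NLS_solution u" and P: "\<And>t. t \<ge> 0 \<Longrightarrow> momentum (u t) = 0" and x: "continuous_on {0..} x"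
    and M: "M > 0" "\<And>t. t \<ge> 0 \<Longrightarrow> (LINT y|lebesgue. (cmod (u t y))\<^sup>2) = M"
    and B: "B > 0" "\<And>t. t \<ge> 0 \<Longrightarrow> (LINT y|lebesgue. energy_density (u t) y) \<le> B"
    and tight: "\<And>\<epsilon>. \<epsilon> > 0 \<Longrightarrow> \<exists>A>0. \<forall>t\<ge>0. (LINT y|lebesgue. indicator {y. A \<le> norm (y + x t)} y * energy_density (u t) y) \<le> \<epsilon>"
    and \<delta>: "\<delta> > 0"
  shows "\<exists>C. \<forall>T\<ge>0. \<bar>x T $ j\<bar> \<le> \<delta> * T + C"
proof -
  \<comment> \<open>\<open>K\<close> makes the near part of the flux at most an eighth of \<delta>
    \<open>M\<close>; being at least 1, it also gives \<open>R\<close> at least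
    \<open>X + A\<close>.\<close>
  define K where "K = max 1 (8 * B / (\<delta> * M))"
  \<comment> \<open>The first bound controls the far part of the flux; the second lets the error
    \<open>4 * R * \<epsilon>\<close> be absorbed, since \<open>R\<close> is \<open>K\<close> times
    \<open>X + A\<close>.\<close>
  define \<epsilon> where "\<epsilon> = min (\<delta> * M / 16) (M / (16 * K))"
  have K: "K \<ge> 1" "1 / K * B \<le> \<delta> * M / 8"
  proof -
    show "K \<ge> 1" by (simp add: K_def)
    have "8 * B / (\<delta> * M) \<le> K" by (simp add: K_def)
    with \<open>K \<ge> 1\<close> M(1) \<delta> show "1 / K * B \<le> \<delta> * M / 8" by (simp add: field_simps)
  qed
  have \<epsilon>: "\<epsilon> > 0" "2 * \<epsilon> \<le> \<delta> * M / 8" "4 * (K * \<epsilon>) \<le> M / 4"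
  proof -
    show "\<epsilon> > 0" using M(1) \<delta> K(1) by (simp add: \<epsilon>_def)
    show "2 * \<epsilon> \<le> \<delta> * M / 8" by (simp add: \<epsilon>_def)
    have "\<epsilon> \<le> M / (16 * K)" by (simp add: \<epsilon>_def)
    with K(1) show "4 * (K * \<epsilon>) \<le> M / 4" by (simp add: field_simps)
  qed
  obtain A where A: "A > 0" "\<And>t. t \<ge> 0 \<Longrightarrow> (LINT y|lebesgue. indicator {y. A \<le> norm (y + x t)} y * energy_density (u t) y) \<le> \<epsilon>"
    using tight[OF \<epsilon>(1)] by blast
  have H: "u t \<in> H1" if "t \<ge> 0" for t by (rule NLS_solution_H1[OF u that])
  have "\<bar>x T $ j\<bar> \<le> \<delta> * T + (4 * \<bar>x 0 $ j\<bar> + 9 * A)" if T: "T \<ge> 0" for T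
  proof -
    have "continuous_on {0..T} (\<lambda>t. \<bar>x t $ j\<bar>)"
      by (intro continuous_intros continuous_on_subset[OF x]) auto
    \<comment> \<open>A maximizer rather than \<open>T\<close> itself: the errors scale with the
      maximum, so the lower bound must be evaluated where it is attained.\<close>
    then obtain s where s: "s \<in> {0..T}" "\<And>t. t \<in> {0..T} \<Longrightarrow> \<bar>x t $ j\<bar> \<le> \<bar>x s $ j\<bar>"
      using continuous_attains_sup[of "{0..T}" "\<lambda>t. \<bar>x t $ j\<bar>"] T by auto
    define X where "X = \<bar>x s $ j\<bar>"
    define R where "R = K * (X + A)"
    define Z where "Z = (\<lambda>t. LINT y|lebesgue. R * sin (y $ j / R) * (cmod (u t y))\<^sup>2)"
    have X: "X \<ge> 0" by (simp add: X_def)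
    have R: "R > 0" "X + A \<le> R" using K(1) X A(1) by (auto simp: R_def)
    have flux: "\<bar>2 * Im (current (\<lambda>y. R * sin (y $ j / R)) (u t))\<bar> \<le> \<delta> * M / 4" if t: "t \<in> {0..s}" for t
    proof -
      have t0: "t \<ge> 0" "t \<in> {0..T}" using t s(1) by auto
      have "\<bar>cos (y $ j / R) - 1\<bar> \<le> 1 / K" if "y \<notin> {y. A \<le> norm (y + x t)}" for y
      proof -
        have "\<bar>y $ j\<bar> \<le> X + A"
          using component_le_norm_cart[of "y + x t" j] that s(2)[OF t0(2)] by (simp add: X_def)
        then have "\<bar>y $ j\<bar> / R \<le> (X + A) / R" using R(1) by (intro divide_right_mono) auto
        also have "\<dots> = 1 / K" using K(1) X A(1) by (simp add: R_def)
        finally have "\<bar>y $ j\<bar> / R \<le> 1 / K" .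
        moreover have "\<bar>cos (y $ j / R) - 1\<bar> \<le> \<bar>y $ j\<bar> / R"
          using abs_cos_diff_le[of "y $ j / R" 0] R(1) by simp
        ultimately show ?thesis by linarith
      qed
      then have "\<bar>2 * Im (current (\<lambda>y. R * sin (y $ j / R)) (u t))\<bar>
         \<le> 1 / K * (LINT y|lebesgue. energy_density (u t) y)
          + 2 * (LINT y|lebesgue. indicator {y. A \<le> norm (y + x t)} y * energy_density (u t) y)"
        using K(1) by (intro current_sin_le H P t0 R exterior_measurable) auto
      also have "\<dots> \<le> 1 / K * B + 2 * \<epsilon>"
        using K(1) by (intro add_mono mult_left_mono B A t0) auto
      finally show ?thesis using K(2) \<epsilon>(2) by linarith
    qed
    have "norm (Z s - Z 0) \<le> \<delta> * M / 4 * norm (s - 0)"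
    proof (rule field_differentiable_bound[of "{0..s}"])
      fix t assume t: "t \<in> {0..s}"
      show "(Z has_real_derivative 2 * Im (current (\<lambda>y. R * sin (y $ j / R)) (u t))) (at t within {0..s})"
        unfolding Z_def using t
        by (intro DERIV_subset[OF has_real_derivative_weighted_mass[OF u _ smooth_multiplier_sin[OF R(1)]]]) auto
      show "norm (2 * Im (current (\<lambda>y. R * sin (y $ j / R)) (u t))) \<le> \<delta> * M / 4"
        using flux[OF t] by simp
    qed (use s(1) in auto)
    moreover have "\<delta> * M / 4 * s \<le> \<delta> * M / 4 * T"
      using s(1) \<delta> M(1) by (intro mult_left_mono) auto
    ultimately have drift: "\<bar>Z s - Z 0\<bar> \<le> \<delta> * M / 4 * T" using s(1) by simp
    have center: "\<bar>Z t - R * sin (- x t $ j / R) * M\<bar> \<le> A * M + 2 * R * \<epsilon>" if t: "t \<ge> 0" for t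
    proof -
      have "\<bar>Z t - R * sin (- x t $ j / R) * M\<bar>
        \<le> A * M + 2 * R * (LINT y|lebesgue. indicator {y. A \<le> norm (y + x t)} y * energy_density (u t) y)"
        using weighted_mass_sin[OF H[OF t] R(1) A(1), of j "x t"] by (simp only: Z_def M(2)[OF t])
      also have "\<dots> \<le> A * M + 2 * R * \<epsilon>"
        using R(1) A(2)[OF t] by (intro add_left_mono mult_left_mono) auto
      finally show ?thesis .
    qed
    have "R * \<bar>sin (- x s $ j / R)\<bar> \<ge> X / 2"
    proof -
      \<comment> \<open>\<open>R\<close> exceeds \<open>X\<close>, which keeps the argument in the
        range where sine is at least half its argument in size.\<close>
      have "\<bar>- x s $ j / R\<bar> \<le> 1" using R A(1) by (simp add: X_def)
      from mult_left_mono[OF abs_sin_ge_half[OF this], of R] R(1) show ?thesis by (simp add: X_def)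
    qed
    then have end_s: "\<bar>R * sin (- x s $ j / R) * M\<bar> \<ge> X / 2 * M"
      using R(1) M(1) by (simp add: abs_mult)
    have "R * \<bar>sin (- x 0 $ j / R)\<bar> \<le> \<bar>x 0 $ j\<bar>"
      using mult_left_mono[OF abs_sin_diff_le[of "- x 0 $ j / R" 0], of R] R(1) by (simp add: abs_divide)
    then have end_0: "\<bar>R * sin (- x 0 $ j / R) * M\<bar> \<le> \<bar>x 0 $ j\<bar> * M"
      using R(1) M(1) by (simp add: abs_mult)
    \<comment> \<open>This costs half of the lower bound \<open>X / 2 * M\<close>; a quarter of
      \<open>X\<close> survives.\<close>
    have "4 * R * \<epsilon> \<le> M / 4 * (X + A)"
      using mult_right_mono[OF \<epsilon>(3), of "X + A"] X A(1) by (simp add: R_def mult_ac)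
    moreover have "X / 2 * M \<le> \<delta> * M / 4 * T + 2 * (A * M + 2 * R * \<epsilon>) + \<bar>x 0 $ j\<bar> * M"
    proof -
      have "s \<ge> 0" using s(1) by simp
      have triangle: "Y \<le> D + 2 * Q + E" if "\<bar>a - b\<bar> \<le> D" "\<bar>a - p\<bar> \<le> Q" "\<bar>b - q\<bar> \<le> Q" "Y \<le> \<bar>p\<bar>" "\<bar>q\<bar> \<le> E"
        for a b p q D E Q Y :: real
        using that by linarith
      show ?thesis by (rule triangle[OF drift center[OF \<open>s \<ge> 0\<close>] center[OF order_refl] end_s end_0])
    qed
    moreover have "2 * (A * M + 2 * R * \<epsilon>) = 2 * (A * M) + 4 * R * \<epsilon>" by (simp add: distrib_left)
    ultimately have "X / 2 * M \<le> \<delta> * M / 4 * T + 2 * (A * M) + M / 4 * (X + A) + \<bar>x 0 $ j\<bar> * M"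
      by linarith
    then have "M * (X / 2) \<le> M * (\<delta> * T / 4 + 2 * A + (X + A) / 4 + \<bar>x 0 $ j\<bar>)"
      by (simp add: algebra_simps)
    then have "X / 2 \<le> \<delta> * T / 4 + 2 * A + (X + A) / 4 + \<bar>x 0 $ j\<bar>"
      using M(1) by (simp only: mult_le_cancel_left_pos)
    \<comment> \<open>Multiply by 4 after moving \<open>X / 4\<close> to the left; 9 is 4 times (2 +
      1/4).\<close>
    then have "X \<le> \<delta> * T + (4 * \<bar>x 0 $ j\<bar> + 9 * A)" by (simp add: field_simps)
    then show ?thesis using s(2)[of T] T by (simp add: X_def)
  qed
  then show ?thesis by blast
qed

theorem lemma5p1:
  fixes u :: "real \<Rightarrow> real^3 \<Rightarrow> complex" and x :: "real \<Rightarrow> real^3"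
  assumes "NLS_solution u"
    and "\<exists>t\<ge>0. \<not> (AE y in lebesgue. u t y = 0)"
    and "\<forall>t\<ge>0. momentum (u t) = 0"
    and "continuous_on {0..} x"
    and "compactin H1_topology
           (H1_topology closure_of {(\<lambda>y. u t (y - x t)) | t. t \<ge> 0})"
  shows "((\<lambda>t. x t /\<^sub>R t) \<longlongrightarrow> 0) at_top"
proof -
  let ?S = "{(\<lambda>y. u t (y - x t)) | t. t \<ge> 0}"
  have H: "u t \<in> H1" if "t \<ge> 0" for t by (rule NLS_solution_H1[OF assms(1) that])
  have "(\<lambda>y. u t (y - x t)) \<in> H1" if "t \<ge> 0" for t
    using H1_translate[OF H[OF that], of "- x t"] by simp
  then have S: "?S \<subseteq> H1" by auto
  obtain M where M: "\<And>t. t \<ge> 0 \<Longrightarrow> (LINT y|lebesgue. (cmod (u t y))\<^sup>2) = M"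
    using mass_conserved[OF assms(1)] by blast
  \<comment> \<open>For the zero solution every continuous \<open>x\<close> yields a precompact set
    and the claim fails; nontriviality enters here, through division by the mass.\<close>
  have "M > 0"
  proof -
    obtain t where t: "t \<ge> 0" "\<not> (AE y in lebesgue. u t y = 0)" using assms(2) by blast
    have "(LINT y|lebesgue. (cmod (u t y))\<^sup>2) \<noteq> 0"
      using H1_D(1)[OF H[OF t(1)]] t(2) integral_nonneg_eq_0_iff_AE[of lebesgue "\<lambda>y. (cmod (u t y))\<^sup>2"]
      by (auto simp: square_integrable_def)
    moreover have "(LINT y|lebesgue. (cmod (u t y))\<^sup>2) \<ge> 0" by simp
    ultimately show ?thesis using M[OF t(1)] by simp
  qed
  obtain B where B: "B > 0" "\<And>g. g \<in> ?S \<Longrightarrow> (LINT y|lebesgue. energy_density g y) \<le> B"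
    using H1_precompact_bounded[OF assms(5) S] by blast
  have B': "(LINT y|lebesgue. energy_density (u t) y) \<le> B" if t: "t \<ge> 0" for t
  proof -
    have "(LINT y|lebesgue. energy_density (\<lambda>y. u t (y - x t)) y) \<le> B" by (rule B(2)) (use t in blast)
    with energy_translate[OF H[OF t], of "\<lambda>_. 1" "- x t"] show ?thesis by simp
  qed
  have tight: "\<exists>A>0. \<forall>t\<ge>0. (LINT y|lebesgue. indicator {y. A \<le> norm (y + x t)} y * energy_density (u t) y) \<le> \<epsilon>"
    if \<epsilon>: "\<epsilon> > 0" for \<epsilon>
  proof -
    obtain A where A: "A > 0" "\<And>g. g \<in> ?S \<Longrightarrow> (LINT y|lebesgue. indicator {y. A \<le> norm y} y * energy_density g y) \<le> \<epsilon>"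
      using H1_precompact_tight[OF assms(5) S \<epsilon>] by blast
    have "(LINT y|lebesgue. indicator {y. A \<le> norm (y + x t)} y * energy_density (u t) y) \<le> \<epsilon>" if t: "t \<ge> 0" for t
    proof -
      have "(LINT y|lebesgue. indicator {y. A \<le> norm y} y * energy_density (\<lambda>y. u t (y - x t)) y) \<le> \<epsilon>"
        by (rule A(2)) (use t in blast)
      moreover have "(indicator {y. A \<le> norm y} :: real^3 \<Rightarrow> real) \<in> borel_measurable lebesgue"
        using exterior_measurable[of A 0] by (intro borel_measurable_indicator) simp
      moreover have "indicator {y. A \<le> norm y} (y + x t) = (indicator {y. A \<le> norm (y + x t)} y :: real)" for y
        by (simp add: indicator_def)
      ultimately show ?thesis
        using energy_translate[OF H[OF t], of "indicator {y. A \<le> norm y}" "- x t"] by simp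
    qed
    with A(1) show ?thesis by blast
  qed
  show ?thesis
  proof (rule vec_tendstoI)
    fix j
    show "((\<lambda>t. (x t /\<^sub>R t) $ j) \<longlongrightarrow> 0 $ j) at_top"
    proof (rule tendstoI)
      fix e :: real assume e: "e > 0"
      then obtain C where C: "\<And>t. t \<ge> 0 \<Longrightarrow> \<bar>x t $ j\<bar> \<le> e / 2 * t + C"
        using sublinear_drift[OF assms(1) _ assms(4) \<open>M > 0\<close> M B(1) B' tight, of "e / 2" j] assms(3) by auto
      show "\<forall>\<^sub>F t in at_top. dist ((x t /\<^sub>R t) $ j) (0 $ j) < e"
        \<comment> \<open>Half of \<open>e\<close> is reserved for the constant \<open>C\<close>,
          which \<open>e / 2 * t\<close> exceeds beyond \<open>2 * C / e\<close>; the maximum with 0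
          keeps \<open>t\<close> positive when \<open>C\<close> is negative.\<close>
        using eventually_gt_at_top[of "max 0 (2 * C / e)"]
      proof eventually_elim
        fix t assume t: "max 0 (2 * C / e) < t"
        then have "C < e / 2 * t" using e by (simp add: field_simps)
        with C[of t] t have "\<bar>x t $ j\<bar> < e * t" by simp
        with t show "dist ((x t /\<^sub>R t) $ j) (0 $ j) < e"
          by (simp add: dist_real_def abs_mult field_simps)
      qed
    qed
  qed
qed

end
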